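(* Let $\mathcal S=\{\phi_e\}_{e\in E}$ be a finitely irreducible conformal GDMS (graph directed Markov system) in $\mathbb R^n$ such that $$X\setminus \overline{\bigcup_{e\in E}\phi_e(X_{t(e)})}\neq\emptyset .$$ Let $\tilde\mu$ be any $\sigma$-invariant ergodic Borel probability measure on $E_A^{\mathbb N}$ with finite Lyapunov exponent $\chi_{\tilde\mu}(\sigma)$. Then $J_{\mathcal S}$ is mean porous at $\tilde\mu\circ\pi^{-1}$-a.e. $x\in J_{\mathcal S}$ with porosity constants depending only on $\mathcal S$ and $\tilde\mu$; that is, there are $\alpha,p\in(0,1)$ depending only on $\mathcal S$ and $\tilde\mu$ such that $J_{\mathcal S}$ is $(\alpha,p)$-mean porous at $\tilde\mu\circ\pi^{-1}$-a.e. $x\in J_{\mathcal S}$.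
   Context: A GDMS $\mathcal S=\{V,E,A,t,i,\{X_v\}_{v\in V},\{\phi_e\}_{e\in E}\}$, abbreviated $\{\phi_e\}_{e\in E}$, consists of: a directed multigraph with a countable (finite or infinite) set of edges $E$ (the alphabet, having at least two elements) and a finite set of vertices $V$; an incidence matrix $A:E\times E\to\{0,1\}$; maps $i,t:E\to V$ with $t(a)=i(b)$ whenever $A_{ab}=1$; non-empty compact metric spaces $X_v$; injective contractions $\phi_e:X_{t(e)}\to X_{i(e)}$, all with Lipschitz constant at most a common $s\in(0,1)$. For every $v\in V$ there are $e,e'\in E$ with $t(e)=v$, $i(e')=v$. $E_A^n$ is the set of words $\omega=\omega_1\ldots\omega_n$ with $A_{\omega_k\omega_{k+1}}=1$ for all $k<n$; $E_A^*=\bigcup_{n\ge0}E_A^n$; $E_A^{\mathbb N}$ is the set of infinite admissible words, with the topology inherited from the product of discrete spaces; $\omega|_n=\omega_1\ldots\omega_n$; $\sigma$ is the left shift on $E_A^{\mathbb N}$. For $\omega\in E_A^n$, $n\ge1$, $\phi_\omega=\phi_{\omega_1}\circ\cdots\circ\phi_{\omega_n}:X_{t(\omega)}\to X_{i(\omega)}$ with $t(\omega)=t(\omega_n)$, $i(\omega)=i(\omega_1)$. $\mathcal S$ is finitely irreducible if there is a finite $\Lambda\subset E_A^*$ such that for all $a,b\in E$ there is $\omega\in\Lambda$ with $a\omega b\in E_A^*$. $X=\bigcup_{v}X_v$ (disjoint union), $\pi(\omega)$ is the unique point of $\bigcap_n\phi_{\omega|_n}(X_{t(\omega_n)})$ for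 $\omega\in E_A^{\mathbb N}$, and $J_{\mathcal S}=\pi(E_A^{\mathbb N})$ is the limit set. The GDMS is conformal if (1) each $X_v$ is a compact connected subset of a fixed $\mathbb R^n$ with $X_v=\overline{\operatorname{Int}X_v}$; (2) (open set condition) $\phi_a(\operatorname{Int}X_{t(a)})\cap\phi_b(\operatorname{Int}X_{t(b)})=\emptyset$ for $a\ne b$ in $E$; (3) for each $v$ there is an open connected $W_v\supset X_v$ such that each $\phi_e$ with $t(e)=v$ extends to a $C^1$ conformal diffeomorphism of $W_v$ into $W_{i(e)}$ (conformal: the derivative at each point is a similarity). Standing assumptions: compact sets $S_v$ with $X_v\subset\operatorname{Int}S_v\subset S_v\subset W_v$ are fixed, pairwise disjoint; and bounded distortion holds: there are $\alpha>0$, $K\ge1$ with $\big|\|D\phi_\omega(p)\|/\|D\phi_\omega(q)\|-1\big|\le K|p-q|^\alpha$ and $K^{-1}\le\|D\phi_\omega(p)\|/\|D\phi_\omega(q)\|\le K$ for all $\omega\in E_A^*$, $p,q\in S_{t(\omega)}$. The Lyapunov exponent is $\chi_{\tilde\mu}(\sigma)=-\int_{E_A^{\mathbb N}}\log\|D\phi_{\omega_1}(\pi(\sigma(\omega)))\|\,d\tilde\mu(\omega)>0$. Mean porosity (in $\mathbb R^n$): for $G\subset\mathbb R^n$, $x\in\mathbb R^n$, $r>0$, $\operatorname{por}(G,x,r)=\sup\{c\ge0: B(y,cr)\subset B(x,r)\setminus G\text{ for some }y\in\mathbb R^n\}$. $G$ is $(\alpha,p)$-mean porous at $x$ if $$\sup_{s>0}\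 \sup_{\beta>\alpha}\ \liminf_{i\to\infty}\frac{\sharp\{j\in[1,i]\cap\mathbb N:\operatorname{por}(G,x,s2^{-j})>\beta\}}{i}>p$$ (the value is the same if $s$ is restricted to $(0,1/2]$). *)

theory Defs
  imports "HOL-Probability.Probability"
begin

text \<open>The maps are total functions; only the values of \<open>fmap S e\<close> on the set attached to the vertex
  \<open>tvert S e\<close> matter: \<open>fmap S e\<close> goes from \<open>xset S (tvert S e)\<close> to \<open>xset S (ivert S e)\<close>.\<close>

record ('v, 'e, 'a) gdms =
  verts :: "'v set"
  edges :: "'e set"
  incid :: "'e \<Rightarrow> 'e \<Rightarrow> bool"
  ivert :: "'e \<Rightarrow> 'v"
  tvert :: "'e \<Rightarrow> 'v"
  xset :: "'v \<Rightarrow> 'a set"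
  fmap :: "'e \<Rightarrow> 'a \<Rightarrow> 'a"

definition is_gdms :: "('v, 'e, 'a::metric_space, 'm) gdms_scheme \<Rightarrow> bool" where
  "is_gdms S \<longleftrightarrow>
     finite (verts S) \<and>
     countable (edges S) \<and> (\<exists>a\<in>edges S. \<exists>b\<in>edges S. a \<noteq> b) \<and>
     (\<forall>e\<in>edges S. ivert S e \<in> verts S \<and> tvert S e \<in> verts S) \<and>
     (\<forall>a\<in>edges S. \<forall>b\<in>edges S. incid S a b \<longrightarrow> tvert S a = ivert S b) \<and>
     (\<forall>v\<in>verts S. \<exists>e\<in>edges S. \<exists>e'\<in>edges S. tvert S e = v \<and> ivert S e' = v) \<and>
     (\<forall>v\<in>verts S. xset S v \<noteq> {} \<and> compact (xset S v)) \<and>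
     (\<forall>e\<in>edges S. fmap S e ` xset S (tvert S e) \<subseteq> xset S (ivert S e) \<and>
        inj_on (fmap S e) (xset S (tvert S e))) \<and>
     (\<exists>s. 0 < s \<and> s < 1 \<and> (\<forall>e\<in>edges S. s-lipschitz_on (xset S (tvert S e)) (fmap S e)))"

definition fin_words :: "('v, 'e, 'a, 'm) gdms_scheme \<Rightarrow> 'e list set" where
  "fin_words S = {w. set w \<subseteq> edges S \<and> successively (incid S) w}"

text \<open>Infinite words are indexed from 0, so \<open>\<omega> k\<close> is the letter \<open>\<omega>\<^sub>k\<^sub>+\<^sub>1\<close>.\<close>

definition inf_words :: "('v, 'e, 'a, 'm) gdms_scheme \<Rightarrow> (nat \<Rightarrow> 'e) set" where
  "inf_words S = {\<omega>. \<forall>k. \<omega> k \<in> edges S \<and> incid S (\<omega> k) (\<omega> (Suc k))}"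

definition shift :: "(nat \<Rightarrow> 'e) \<Rightarrow> nat \<Rightarrow> 'e" where
  "shift \<omega> = (\<lambda>k. \<omega> (Suc k))"

definition inf_words_topology :: "('v, 'e, 'a, 'm) gdms_scheme \<Rightarrow> (nat \<Rightarrow> 'e) topology" where
  "inf_words_topology S =
     subtopology (product_topology (\<lambda>_. discrete_topology (edges S)) UNIV) (inf_words S)"

definition inf_words_borel :: "('v, 'e, 'a, 'm) gdms_scheme \<Rightarrow> (nat \<Rightarrow> 'e) set set" where
  "inf_words_borel S = sigma_sets (inf_words S) {U. openin (inf_words_topology S) U}"

definition finitely_irreducible :: "('v, 'e, 'a, 'm) gdms_scheme \<Rightarrow> bool" where
  "finitely_irreducible S \<longleftrightarrow>
     (\<exists>\<Lambda>. finite \<Lambda> \<and> \<Lambda> \<subseteq> fin_words S \<and>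
        (\<forall>a\<in>edges S. \<forall>b\<in>edges S. \<exists>w\<in>\<Lambda>. [a] @ w @ [b] \<in> fin_words S))"

definition word_map :: "('v, 'e, 'a, 'm) gdms_scheme \<Rightarrow> 'e list \<Rightarrow> 'a \<Rightarrow> 'a" where
  "word_map S w = foldr (\<lambda>e f. fmap S e \<circ> f) w id"

definition coding_map :: "('v, 'e, 'a, 'm) gdms_scheme \<Rightarrow> (nat \<Rightarrow> 'e) \<Rightarrow> 'a" where
  "coding_map S \<omega> =
     (THE x. x \<in> (\<Inter>n\<in>{1..}. word_map S (map \<omega> [0..<n]) ` xset S (tvert S (\<omega> (n - 1)))))"

definition limit_set :: "('v, 'e, 'a, 'm) gdms_scheme \<Rightarrow> 'a set" where
  "limit_set S = coding_map S ` inf_words S"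

definition total_xset :: "('v, 'e, 'a, 'm) gdms_scheme \<Rightarrow> 'a set" where
  "total_xset S = (\<Union>v\<in>verts S. xset S v)"

definition C1_on :: "('a::real_normed_vector \<Rightarrow> 'b::real_normed_vector) \<Rightarrow> 'a set \<Rightarrow> bool" where
  "C1_on f U \<longleftrightarrow>
     (\<exists>f' :: 'a \<Rightarrow> 'a \<Rightarrow>\<^sub>L 'b.
        (\<forall>x\<in>U. (f has_derivative blinfun_apply (f' x)) (at x)) \<and> continuous_on U f')"

definition C1_diffeo_into ::
    "('a::real_normed_vector \<Rightarrow> 'b::real_normed_vector) \<Rightarrow> 'a set \<Rightarrow> 'b set \<Rightarrow> bool" where
  "C1_diffeo_into f U U' \<longleftrightarrow>
     f ` U \<subseteq> U' \<and> inj_on f U \<and> open (f ` U) \<and>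
     C1_on f U \<and> C1_on (the_inv_into U f) (f ` U)"

definition linear_similarity :: "('a::real_normed_vector \<Rightarrow> 'b::real_normed_vector) \<Rightarrow> bool" where
  "linear_similarity L \<longleftrightarrow> linear L \<and> (\<exists>c>0. \<forall>u. norm (L u) = c * norm u)"

definition conformal_on :: "('a::real_normed_vector \<Rightarrow> 'b::real_normed_vector) \<Rightarrow> 'a set \<Rightarrow> bool" where
  "conformal_on f U \<longleftrightarrow> (\<forall>x\<in>U. linear_similarity (frechet_derivative f (at x)))"

definition deriv_norm :: "('a::real_normed_vector \<Rightarrow> 'b::real_normed_vector) \<Rightarrow> 'a \<Rightarrow> real" where
  "deriv_norm f x = onorm (frechet_derivative f (at x))"

text \<open>In a conformal system \<open>wset S v\<close> is the open set $W_v$ and \<open>sset S v\<close> the compact set $S_v$.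
  The function \<open>fmap S e\<close> stands at the same time for the generator on \<open>xset S (tvert S e)\<close> and for its
  conformal extension to \<open>wset S (tvert S e)\<close>.\<close>

record ('v, 'e, 'a) cgdms = "('v, 'e, 'a) gdms" +
  wset :: "'v \<Rightarrow> 'a set"
  sset :: "'v \<Rightarrow> 'a set"

definition conformal_gdms :: "('v, 'e, 'a::euclidean_space, 'm) cgdms_scheme \<Rightarrow> bool" where
  "conformal_gdms S \<longleftrightarrow>
     is_gdms S \<and>
     (\<forall>v\<in>verts S. connected (xset S v) \<and> xset S v = closure (interior (xset S v))) \<and>
     (\<forall>a\<in>edges S. \<forall>b\<in>edges S. a \<noteq> b \<longrightarrow>
        fmap S a ` interior (xset S (tvert S a)) \<inter> fmap S b ` interior (xset S (tvert S b)) = {}) \<and>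
     (\<forall>v\<in>verts S. open (wset S v) \<and> connected (wset S v) \<and> xset S v \<subseteq> wset S v) \<and>
     (\<forall>e\<in>edges S. C1_diffeo_into (fmap S e) (wset S (tvert S e)) (wset S (ivert S e)) \<and>
        conformal_on (fmap S e) (wset S (tvert S e)))"

definition compact_neighbourhoods :: "('v, 'e, 'a::euclidean_space, 'm) cgdms_scheme \<Rightarrow> bool" where
  "compact_neighbourhoods S \<longleftrightarrow>
     (\<forall>v\<in>verts S. compact (sset S v) \<and> xset S v \<subseteq> interior (sset S v) \<and> sset S v \<subseteq> wset S v) \<and>
     disjoint_family_on (sset S) (verts S)"

definition bounded_distortion :: "('v, 'e, 'a::euclidean_space, 'm) cgdms_scheme \<Rightarrow> bool" where
  "bounded_distortion S \<longleftrightarrow>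
     (\<exists>\<alpha> K. \<alpha> > 0 \<and> K \<ge> 1 \<and>
        (\<forall>w\<in>fin_words S. w \<noteq> [] \<longrightarrow>
          (\<forall>p\<in>sset S (tvert S (last w)). \<forall>q\<in>sset S (tvert S (last w)).
             \<bar>deriv_norm (word_map S w) p / deriv_norm (word_map S w) q - 1\<bar> \<le> K * dist p q powr \<alpha> \<and>
             1 / K \<le> deriv_norm (word_map S w) p / deriv_norm (word_map S w) q \<and>
             deriv_norm (word_map S w) p / deriv_norm (word_map S w) q \<le> K)))"

definition borel_prob_on_inf_words ::
    "('v, 'e, 'a, 'm) gdms_scheme \<Rightarrow> (nat \<Rightarrow> 'e) measure \<Rightarrow> bool" where
  "borel_prob_on_inf_words S \<mu> \<longleftrightarrow>
     prob_space \<mu> \<and> space \<mu> = inf_words S \<and> sets \<mu> = inf_words_borel S"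

definition shift_invariant :: "(nat \<Rightarrow> 'e) measure \<Rightarrow> bool" where
  "shift_invariant \<mu> \<longleftrightarrow> (\<forall>B\<in>sets \<mu>. emeasure \<mu> (shift -` B \<inter> space \<mu>) = emeasure \<mu> B)"

definition shift_ergodic :: "(nat \<Rightarrow> 'e) measure \<Rightarrow> bool" where
  "shift_ergodic \<mu> \<longleftrightarrow>
     (\<forall>B\<in>sets \<mu>. shift -` B \<inter> space \<mu> = B \<longrightarrow> measure \<mu> B = 0 \<or> measure \<mu> B = 1)"

text \<open>The derivatives of the generators of a conformal system have norm at most \<open>s < 1\<close> on the sets \<open>xset S v\<close>,
  so the integrand is positive and the truncation performed by \<open>ennreal\<close> is harmless.\<close>

definition lyapunov_exponent ::
    "('v, 'e, 'a::euclidean_space, 'm) gdms_scheme \<Rightarrow> (nat \<Rightarrow> 'e) measure \<Rightarrow> ennreal" where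
  "lyapunov_exponent S \<mu> =
     (\<integral>\<^sup>+ \<omega>. ennreal (- ln (deriv_norm (fmap S (\<omega> 0)) (coding_map S (shift \<omega>)))) \<partial>\<mu>)"

text \<open>With open balls the set below always contains 0, and it is bounded by 1 for \<open>r > 0\<close>.\<close>

definition porosity :: "'a::euclidean_space set \<Rightarrow> 'a \<Rightarrow> real \<Rightarrow> real" where
  "porosity G x r = Sup {c. c \<ge> 0 \<and> (\<exists>y. ball y (c * r) \<subseteq> ball x r - G)}"

definition mean_porous_at :: "real \<Rightarrow> real \<Rightarrow> 'a::euclidean_space set \<Rightarrow> 'a \<Rightarrow> bool" where
  "mean_porous_at \<alpha> p G x \<longleftrightarrow>
     (SUP s\<in>{0<..}. SUP \<beta>\<in>{\<alpha><..}.
        liminf (\<lambda>i. ereal (real (card {j\<in>{1..i}. porosity G x (s / 2 ^ j) > \<beta>}) / real i)))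
     > ereal p"

end

theory Submission
  imports Defs
begin

text \<open>Since \<open>X\<close> is the closure of its interior, some ball in the interior of one set \<open>X\<^sub>v\<close> misses all
  first-level images; the open set condition makes its images under all compositions disjoint from
  the limit set, and irreducibility transports such a hole into every \<open>X\<^sub>v\<close>. By conformality
  and bounded distortion, the image of the hole under \<open>\<phi>\<close> indexed by the first \<open>n\<close> letters of \<open>\<omega>\<close> contains a
  ball of radius \<open>c r\<^sub>n\<close> inside the ball of radius \<open>C r\<^sub>n\<close> about \<open>\<pi>(\<omega>)\<close>, where \<open>r\<^sub>n\<close> is the
  derivative norm at \<open>\<pi>(\<sigma>\<^sup>n \<omega>)\<close>. Now \<open>- ln r\<^sub>n\<close> is a Birkhoff sum of the integrand of the Lyapunov
  exponent. It grows by at least \<open>ln 2\<close> every \<open>m\<close> steps, so the scales \<open>r\<^sub>n\<^sub>m\<close> fall into distinct dyadic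
  shells, and almost surely it grows at most linearly, so these shells have positive lower density.
  For the linear bound the maximal ergodic inequality and ergodicity suffice; the pointwise ergodic
  theorem is not needed.\<close>

section \<open>Topology and geometry\<close>

text \<open>A lower bound on the derivative gives no direct distance estimate for \<open>f\<close>,
  so the estimate is made for the inverse. Let R be the distance from \<open>f z\<close> to the
  image of the sphere. The ball of radius R about \<open>f z\<close> lies in the image and is
  convex, so the mean value inequality makes the inverse (1/\<kappa>)-Lipschitz there. The point
  where R is attained pulls back to distance at most R/\<kappa> from \<open>z\<close>, whence \<rho>
  \<le> R/\<kappa>.\<close>

lemma ball_subset_image_of_similarity:
  fixes f :: "'a::euclidean_space \<Rightarrow> 'a"
  assumes W: "open W" "cball z \<rho> \<subseteq> W" and inj: "inj_on f W" and \<rho>: "\<rho> > 0" and \<kappa>: "\<kappa> > 0"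
    and der: "\<And>p. p \<in> W \<Longrightarrow> (f has_derivative D p) (at p)"
    and sim: "\<And>p. p \<in> W \<Longrightarrow> linear_similarity (D p)"
    and lower: "\<And>p. p \<in> cball z \<rho> \<Longrightarrow> \<kappa> \<le> onorm (D p)"
  shows "ball (f z) (\<kappa> * \<rho>) \<subseteq> f ` ball z \<rho>"
proof -
  have contW: "continuous_on W f"
    using der has_derivative_continuous continuous_at_imp_continuous_on by blast
  have img_open: "open (f ` U)" if "open U" "U \<subseteq> W" for U
    using invariance_of_domain that contW inj continuous_on_subset inj_on_subset by metis
  obtain g where hom: "homeomorphism W (f ` W) f g"
    using invariance_of_domain_homeomorphism[OF W(1) contW _ inj] by auto
  have gf: "g (f p) = p" if "p \<in> W" for p using hom that by (simp add: homeomorphism_def)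
  have fg: "f (g y) = y" if "y \<in> f ` W" for y using gf that by auto
  have contg: "continuous_on (f ` W) g" using hom by (simp add: homeomorphism_def)
  have zW: "z \<in> W" using W(2) \<rho> by auto
  have sph: "sphere z \<rho> \<subseteq> W" using W(2) by auto
  have "sphere z \<rho> \<noteq> {}" using \<rho> by simp
  moreover have "continuous_on (sphere z \<rho>) (\<lambda>p. dist (f z) (f p))"
    by (intro continuous_intros continuous_on_subset[OF contW sph])
  ultimately obtain p where p: "p \<in> sphere z \<rho>"
      and pmin: "\<And>q. q \<in> sphere z \<rho> \<Longrightarrow> dist (f z) (f p) \<le> dist (f z) (f q)"
    using continuous_attains_inf[OF compact_sphere] by metis
  define R where "R = dist (f z) (f p)"
  have "f z \<noteq> f p" using inj_onD[OF inj _ zW, of p] p sph \<rho> by auto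
  then have R: "R > 0" by (simp add: R_def)
  have sub: "ball (f z) R \<subseteq> f ` ball z \<rho>"
  proof (rule ball_subset_open_map_image)
    show "continuous_on (closure (ball z \<rho>)) f"
      using contW W(2) \<rho> by (simp add: continuous_on_subset)
    have "ball z \<rho> \<subseteq> W" using W(2) by auto
    then show "open (f ` interior (ball z \<rho>))"
      using img_open[of "ball z \<rho>"] by (simp add: interior_open)
    show "R \<le> norm (f q - f z)" if "q \<in> frontier (ball z \<rho>)" for q
      using pmin[of q] that \<rho> by (simp add: R_def dist_norm norm_minus_commute)
  qed (use \<rho> R in auto)
  have cpt: "compact (f ` cball z \<rho>)"
    by (rule compact_continuous_image[OF continuous_on_subset[OF contW W(2)]]) simp
  \<comment> \<open>The nearest point \<open>f p\<close> lies on the boundary of the ball. Passing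
    the estimate for \<open>g\<close> to it by continuity requires the closed ball to lie in the
    image.\<close>
  have csub: "cball (f z) R \<subseteq> f ` cball z \<rho>"
  proof -
    have "closure (ball (f z) R) \<subseteq> closure (f ` cball z \<rho>)"
      using sub ball_subset_cball by (intro closure_mono) blast
    then show ?thesis using R cpt by (simp add: compact_imp_closed)
  qed
  have bound: "norm (g y - z) \<le> R / \<kappa>" if y: "y \<in> ball (f z) R" for y
  proof -
    \<comment> \<open>Candidate for the derivative of \<open>g\<close>. The similarity ratio of
      \<open>D (g y)\<close> is at least \<kappa>, so its inverse has norm at most
      1/\<kappa>.\<close>
    define L where "L = (\<lambda>y. inv (D (g y)))"
    have gder: "(g has_derivative L y) (at y)" "onorm (L y) \<le> 1 / \<kappa>" if y: "y \<in> ball (f z) R" for y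
    proof -
      have gy: "g y \<in> ball z \<rho>" using sub y gf W(2) ball_subset_cball by fastforce
      then have gW: "g y \<in> W" using W(2) by auto
      obtain c where c: "c > 0" "\<And>u. norm (D (g y) u) = c * norm u"
        and lin: "linear (D (g y))" using sim[OF gW] unfolding linear_similarity_def by auto
      have "onorm (D (g y)) \<le> c" by (rule onorm_le) (simp add: c(2))
      then have kc: "\<kappa> \<le> c" using lower[of "g y"] gy by (simp add: less_imp_le)
      have "inj (D (g y))"
        unfolding linear_injective_0[OF lin] using c
        by (metis mult_eq_0_iff norm_eq_zero less_irrefl)
      then have bij: "bij (D (g y))" using lin by (simp add: linear_injective_imp_surjective bij_def)
      have linL: "linear (L y)" unfolding L_def using lin \<open>inj (D (g y))\<close> by (rule inj_linear_imp_inv_linear)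
      have LD: "L y \<circ> D (g y) = id" using bij by (simp add: L_def bij_is_inj)
      show "(g has_derivative L y) (at y)"
      proof (rule has_derivative_inverse_basic[where T = "f ` W"])
        show "(f has_derivative D (g y)) (at (g y))" using der gW by simp
        show "bounded_linear (L y)" using linL by (simp add: linear_conv_bounded_linear)
        show o: "open (f ` W)" using img_open W(1) by simp
        show yW: "y \<in> f ` W" using sub y W(2) ball_subset_cball by blast
        show "continuous (at y) g" using contg o yW continuous_on_eq_continuous_at by blast
      qed (use LD fg in auto)
      have "norm (L y u) \<le> 1 / \<kappa> * norm u" for u
      proof -
        have "norm u = c * norm (L y u)" using c(2)[of "L y u"] bij
          by (simp add: L_def bij_is_surj surj_f_inv_f)
        then show ?thesis using kc \<kappa> c(1) by (simp add: field_simps mult_right_mono)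
      qed
      then show "onorm (L y) \<le> 1 / \<kappa>" by (rule onorm_le)
    qed
    have "norm (g y - g (f z)) \<le> 1 / \<kappa> * norm (y - f z)"
      by (rule differentiable_bound[of "ball (f z) R" g L])
         (use gder y R in \<open>auto intro: has_derivative_at_withinI\<close>)
    also have "\<dots> \<le> 1 / \<kappa> * R"
      using y \<kappa> by (intro mult_left_mono) (auto simp: dist_norm norm_minus_commute)
    finally show ?thesis using gf zW by simp
  qed
  have "norm (g (f p) - z) \<le> R / \<kappa>"
  proof (rule continuous_on_closure_norm_le[of "ball (f z) R" "\<lambda>y. g y - z"])
    show "continuous_on (closure (ball (f z) R)) (\<lambda>y. g y - z)"
      using csub W(2) R
      by (intro continuous_intros continuous_on_subset[OF contg]) auto
  qed (use bound R in \<open>auto simp: R_def\<close>)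
  moreover have "g (f p) = p" using gf p sph by blast
  ultimately have "\<rho> \<le> R / \<kappa>" using p by (simp add: dist_norm norm_minus_commute)
  then have "\<kappa> * \<rho> \<le> R" using \<kappa> by (simp add: field_simps)
  then show ?thesis using sub subset_ball by blast
qed

text \<open>On a set that is connected but possibly not convex, local control of a map spreads by
  chaining: being joined by a bound C * b is an equivalence relation with open classes, so all
  points are related. A finite \<delta>-net then makes C uniform. The constant precedes
  \<open>g\<close> and \<open>b\<close>, so it serves all compositions at once.\<close>

lemma uniform_oscillation_bound:
  fixes X :: "'a::metric_space set"
  assumes "connected X" "compact X" "\<delta> > 0"
  shows "\<exists>C>0. \<forall>(g::'a \<Rightarrow> 'b::metric_space) b.
           (\<forall>p\<in>X. \<forall>q\<in>X. dist p q < \<delta> \<longrightarrow> dist (g p) (g q) \<le> b) \<longrightarrow>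
           (\<forall>p\<in>X. \<forall>q\<in>X. dist (g p) (g q) \<le> C * b)"
proof -
  define loc where "loc = (\<lambda>(g::'a \<Rightarrow> 'b) b. \<forall>p\<in>X. \<forall>q\<in>X. dist p q < \<delta> \<longrightarrow> dist (g p) (g q) \<le> b)"
  define R where "R = (\<lambda>p q. \<exists>C. \<forall>g b. loc g b \<longrightarrow> dist (g p) (g q) \<le> C * b)"
  have loc0: "b \<ge> 0" if "loc g b" "X \<noteq> {}" for g b
    using that \<open>\<delta> > 0\<close> unfolding loc_def by (metis dist_self ex_in_conv)
  have R: "R p q" if "p \<in> X" "q \<in> X" for p q
  proof (rule connected_equivalence_relation[OF \<open>connected X\<close> that, of R])
    show "R x z" if "R x y" "R y z" for x y z
    proof -
      from that obtain C C' where "\<And>g b. loc g b \<Longrightarrow> dist (g x) (g y) \<le> C * b"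
        "\<And>g b. loc g b \<Longrightarrow> dist (g y) (g z) \<le> C' * b" unfolding R_def by blast
      then have "dist (g x) (g z) \<le> (C + C') * b" if "loc g b" for g b
        using that dist_triangle[of "g x" "g z" "g y"] by (force simp: algebra_simps)
      then show ?thesis unfolding R_def by blast
    qed
    show "\<exists>T. openin (top_of_set X) T \<and> x \<in> T \<and> (\<forall>y\<in>T. R x y)" if "x \<in> X" for x
    proof (intro exI conjI ballI)
      show "openin (top_of_set X) (X \<inter> ball x \<delta>)" by (simp add: openin_open_Int)
      show "x \<in> X \<inter> ball x \<delta>" using that \<open>\<delta> > 0\<close> by simp
      show "R x y" if "y \<in> X \<inter> ball x \<delta>" for y
        using that \<open>x \<in> X\<close> unfolding R_def loc_def by (intro exI[of _ 1]) auto
    qed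
  qed (auto simp: R_def dist_commute)
  then obtain C where C: "\<And>p q g b. p \<in> X \<Longrightarrow> q \<in> X \<Longrightarrow> loc g b \<Longrightarrow> dist (g p) (g q) \<le> C p q * b"
    unfolding R_def by metis
  obtain k where k: "finite k" "k \<subseteq> X" "X \<subseteq> (\<Union>x\<in>k. ball x \<delta>)"
    using compactE_image[OF \<open>compact X\<close>, of X "\<lambda>x. ball x \<delta>"] \<open>\<delta> > 0\<close>
    by (metis (no_types, lifting) UN_iff centre_in_ball open_ball subsetI)
  \<comment> \<open>The sum dominates every constant between net points; the summand 2 pays for the
    two short steps from \<open>p\<close> and \<open>q\<close> to the net.\<close>
  define M where "M = (\<Sum>x\<in>k. \<Sum>y\<in>k. \<bar>C x y\<bar>) + 2"
  have M: "C x y + 2 \<le> M" if "x \<in> k" "y \<in> k" for x y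
  proof -
    have "C x y \<le> \<bar>C x y\<bar>" by simp
    also have "\<dots> \<le> (\<Sum>y\<in>k. \<bar>C x y\<bar>)" using that k(1) by (intro member_le_sum) auto
    also have "\<dots> \<le> (\<Sum>x\<in>k. \<Sum>y\<in>k. \<bar>C x y\<bar>)"
      using that k(1) by (intro member_le_sum[where f = "\<lambda>x. \<Sum>y\<in>k. \<bar>C x y\<bar>"]) (auto intro: sum_nonneg)
    finally show ?thesis by (simp add: M_def)
  qed
  have "dist (g p) (g q) \<le> M * b" if "loc g b" "p \<in> X" "q \<in> X" for g b p q
  proof -
    have "p \<in> (\<Union>x\<in>k. ball x \<delta>)" "q \<in> (\<Union>x\<in>k. ball x \<delta>)" using k(3) that by blast+
    then obtain x y where xy: "x \<in> k" "y \<in> k" "dist x p < \<delta>" "dist y q < \<delta>" unfolding UN_iff mem_ball by blast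
    then have "dist (g p) (g x) \<le> b" "dist (g y) (g q) \<le> b" "dist (g x) (g y) \<le> C x y * b"
      using that k(2) C unfolding loc_def by (auto simp: dist_commute subset_iff)
    then have "dist (g p) (g q) \<le> (C x y + 2) * b"
      using dist_triangle[of "g p" "g q" "g x"] dist_triangle[of "g x" "g q" "g y"]
      by (simp add: algebra_simps)
    also have "\<dots> \<le> M * b"
      using M xy loc0 that by (intro mult_right_mono) auto
    finally show ?thesis .
  qed
  moreover have "M > 0" by (auto simp: M_def intro!: add_nonneg_pos sum_nonneg)
  ultimately show ?thesis unfolding loc_def by blast
qed

section \<open>Linear similarities and their operator norms\<close>

lemma linear_similarity_comp:
  assumes "linear_similarity f" "linear_similarity g"
  shows "linear_similarity (f \<circ> g)"
proof -
  obtain c d where "c > 0" "d > 0" "\<And>u. norm (f u) = c * norm u" "\<And>u. norm (g u) = d * norm u"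
    using assms unfolding linear_similarity_def by auto
  then show ?thesis
    using assms unfolding linear_similarity_def
    by (auto simp: linear_compose intro!: exI[of _ "c * d"])
qed

lemma linear_similarity_onorm:
  fixes L :: "'a::euclidean_space \<Rightarrow> 'b::real_normed_vector"
  assumes "linear_similarity L"
  shows "onorm L > 0" "norm (L u) = onorm L * norm u"
proof -
  obtain c where c: "c > 0" "\<And>u. norm (L u) = c * norm u" and lin: "linear L"
    using assms unfolding linear_similarity_def by auto
  have "onorm L \<le> c" by (rule onorm_le) (simp add: c(2))
  moreover
  obtain e :: 'a where e: "e \<in> Basis" using nonempty_Basis by blast
  have "norm (L e) \<le> onorm L * norm e"
    using onorm lin linear_conv_bounded_linear by blast
  then have "c \<le> onorm L" using c(2)[of e] e by simp
  ultimately have "onorm L = c" by simp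
  then show "onorm L > 0" "norm (L u) = onorm L * norm u" using c by auto
qed

text \<open>For general linear maps the norm is only submultiplicative; for similarities it is the
  scaling ratio, and ratios multiply. This makes derivative norms exactly multiplicative along
  words.\<close>

lemma linear_similarity_onorm_comp:
  fixes f :: "'b::euclidean_space \<Rightarrow> 'c::real_normed_vector" and g :: "'a::euclidean_space \<Rightarrow> 'b"
  assumes "linear_similarity f" "linear_similarity g"
  shows "onorm (f \<circ> g) = onorm f * onorm g"
proof -
  obtain e :: 'a where e: "e \<in> Basis" using nonempty_Basis by blast
  show ?thesis
    using linear_similarity_onorm(2)[OF linear_similarity_comp[OF assms], of e]
      linear_similarity_onorm(2)[OF assms(1), of "g e"] linear_similarity_onorm(2)[OF assms(2), of e] e
    by simp
qed

section \<open>Porosity\<close>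

lemma porosity_set_bounded:
  fixes x :: "'a::euclidean_space"
  assumes "r > 0"
  shows "bdd_above {c. c \<ge> 0 \<and> (\<exists>y. ball y (c * r) \<subseteq> ball x r - G)}"
proof (rule bdd_aboveI[of _ 1], clarsimp)
  fix c y assume "0 \<le> c" and "ball y (c * r) \<subseteq> ball x r - G"
  then have "ball y (c * r) \<subseteq> ball x r" by blast
  then have "dist y x + c * r \<le> r \<or> c * r \<le> 0" by (simp add: ball_subset_ball_iff)
  then have "c * r \<le> 1 * r" using assms zero_le_dist[of y x] by linarith
  then show "c \<le> 1" using assms by simp
qed

lemma less_porosity_iff:
  fixes x :: "'a::euclidean_space"
  assumes "r > 0"
  shows "\<beta> < porosity G x r \<longleftrightarrow> (\<exists>c>\<beta>. c \<ge> 0 \<and> (\<exists>y. ball y (c * r) \<subseteq> ball x r - G))"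
proof -
  have "0 \<in> {c. c \<ge> 0 \<and> (\<exists>y. ball y (c * r) \<subseteq> ball x r - G)}" by simp
  then show ?thesis unfolding porosity_def
    using less_cSup_iff[OF _ porosity_set_bounded[OF assms], of x G \<beta>] by blast
qed

text \<open>Shrinking a hole of relative size c > \<beta> to c' with \<beta> < c' < c leaves room to
  move the centre of the large ball by (c - c') * r. Openness is what later makes the porosity
  counts Borel.\<close>

lemma open_porosity_greater:
  fixes G :: "'a::euclidean_space set"
  assumes "r > 0" "\<beta> \<ge> 0"
  shows "open {x. \<beta> < porosity G x r}"
proof (rule openI, clarsimp)
  fix x assume "\<beta> < porosity G x r"
  then obtain c y where c: "c > \<beta>" and y: "ball y (c * r) \<subseteq> ball x r - G"
    using less_porosity_iff[OF assms(1)] by blast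
  obtain c' where c': "\<beta> < c'" "c' < c" using c dense by blast
  have "ball y (c * r) \<subseteq> ball x r" using y by blast
  \<comment> \<open>A positive radius excludes the empty ball, for which the inclusion would say
    nothing about the centre.\<close>
  moreover have "\<not> c * r \<le> 0" using c assms by (simp add: not_le)
  ultimately have le: "dist y x + c * r \<le> r" by (simp add: ball_subset_ball_iff)
  show "\<exists>e>0. ball x e \<subseteq> {x. \<beta> < porosity G x r}"
  proof (intro exI conjI subsetI CollectI)
    show "(c - c') * r > 0" using c' assms by simp
    fix x' assume x': "x' \<in> ball x ((c - c') * r)"
    then have "dist y x' + c' * r \<le> r"
      using le dist_triangle[of y x' x] by (simp add: algebra_simps)
    then have "ball y (c' * r) \<subseteq> ball x' r" by (simp add: ball_subset_ball_iff)
    moreover have "ball y (c' * r) \<subseteq> ball y (c * r)"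
      using c' assms by (intro subset_ball mult_right_mono) auto
    ultimately show "\<beta> < porosity G x' r"
      unfolding less_porosity_iff[OF assms(1)] using y c' assms(2)
      by (intro exI[of _ c'] conjI exI[of _ y]) auto
  qed
qed

text \<open>One pair of \<open>s\<close> and \<beta> bounds both suprema from below; the gap between
  \<open>p\<close> and \<open>q\<close> turns the weak bound on the liminf into a strict
  one.\<close>

lemma mean_porous_atI:
  assumes "s > 0" "\<alpha> < \<beta>" "p < q"
    and "eventually (\<lambda>i. q * real i \<le> real (card {j\<in>{1..i}. porosity G x (s / 2 ^ j) > \<beta>})) sequentially"
  shows "mean_porous_at \<alpha> p G x"
proof -
  let ?l = "\<lambda>s \<beta>. liminf (\<lambda>i. ereal (real (card {j\<in>{1..i}. porosity G x (s / 2 ^ j) > \<beta>}) / real i))"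
  have "ereal q \<le> ?l s \<beta>"
  proof (rule Liminf_bounded)
    show "\<forall>\<^sub>F i in sequentially.
       ereal q \<le> ereal (real (card {j\<in>{1..i}. porosity G x (s / 2 ^ j) > \<beta>}) / real i)"
      using assms(4) eventually_gt_at_top[of 0]
      by eventually_elim (simp add: field_simps)
  qed
  then have "ereal p < ?l s \<beta>" using assms(3) by (meson ereal_less_eq(3) less_ereal.simps(1) less_le_trans)
  then have "ereal p < (SUP \<beta>\<in>{\<alpha><..}. ?l s \<beta>)"
    using assms(2) by (meson SUP_upper greaterThan_iff less_le_trans)
  then show ?thesis unfolding mean_porous_at_def using assms(1)
    by (meson SUP_upper greaterThan_iff less_le_trans)
qed

text \<open>The values \<open>j 0\<close>, ..., \<open>j N\<close> are distinct good indices, and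
  all are at most \<open>i\<close> once a * N + b \<le> i. This gives about (i - b) / a of them; the
  factor 2 in the density absorbs \<open>b\<close>.\<close>

lemma eventually_card_ge_of_linear_growth:
  fixes j :: "nat \<Rightarrow> nat"
  assumes "strict_mono j" "\<And>n. 1 \<le> j n" "\<And>n. P (j n)" "a > 0" "\<And>n. real (j n) \<le> a * n + b"
  shows "eventually (\<lambda>i. 1 / (2 * a) * real i \<le> real (card {k\<in>{1..i}. P k})) sequentially"
proof -
  \<comment> \<open>The bound by b keeps the argument of the floor nonnegative, and the bound by 2 *
    b gives i - b \<ge> i / 2.\<close>
  have "eventually (\<lambda>i. real i \<ge> max b (2 * b)) sequentially"
    using eventually_ge_at_top[of "nat \<lceil>max b (2 * b)\<rceil>"] by eventually_elim linarith
  then show ?thesis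
  proof eventually_elim
    fix i assume i: "real i \<ge> max b (2 * b)"
    define N where "N = nat \<lfloor>(real i - b) / a\<rfloor>"
    have nn: "(real i - b) / a \<ge> 0" using i assms(4) by simp
    then have N: "real N \<le> (real i - b) / a" "(real i - b) / a \<le> real N + 1"
      unfolding N_def by linarith+
    have "j n \<le> i" if "n \<le> N" for n
    proof -
      have "real (j n) \<le> real (j N)" using assms(1) that by (simp add: strict_mono_less_eq)
      also have "\<dots> \<le> a * N + b" by (rule assms(5))
      also have "\<dots> \<le> real i" using N(1) assms(4) by (simp add: field_simps)
      finally show ?thesis by simp
    qed
    then have "j ` {..N} \<subseteq> {k\<in>{1..i}. P k}" using assms(2,3) by auto
    then have "card (j ` {..N}) \<le> card {k\<in>{1..i}. P k}" by (intro card_mono) auto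
    moreover have "card (j ` {..N}) = N + 1"
      using assms(1) by (subst card_image) (auto simp: strict_mono_eq inj_on_def)
    ultimately have "(real i - b) / a \<le> real (card {k\<in>{1..i}. P k})" using N(2) by linarith
    moreover have "1 / (2 * a) * real i \<le> (real i - b) / a"
      using i assms(4) by (simp add: field_simps)
    ultimately show "1 / (2 * a) * real i \<le> real (card {k\<in>{1..i}. P k})" by linarith
  qed
qed

section \<open>A maximal ergodic inequality\<close>

definition birkhoff_sum :: "('a \<Rightarrow> 'a) \<Rightarrow> ('a \<Rightarrow> real) \<Rightarrow> nat \<Rightarrow> 'a \<Rightarrow> real" where
  "birkhoff_sum T g n x = (\<Sum>k<n. g ((T ^^ k) x))"

lemma birkhoff_sum_0 [simp]: "birkhoff_sum T g 0 x = 0"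
  by (simp add: birkhoff_sum_def)

lemma birkhoff_sum_Suc: "birkhoff_sum T g (Suc n) x = g x + birkhoff_sum T g n (T x)"
  unfolding birkhoff_sum_def by (subst sum.lessThan_Suc_shift) (simp add: funpow_swap1)

lemma birkhoff_sum_diff_const:
  "birkhoff_sum T (\<lambda>x. g x - c) n x = birkhoff_sum T g n x - c * n"
  by (simp add: birkhoff_sum_def sum_subtractf)

text \<open>The recursion computes the maximum of the Birkhoff sums of length at most \<open>n\<close>.\<close>

primrec max_birkhoff :: "('a \<Rightarrow> 'a) \<Rightarrow> ('a \<Rightarrow> real) \<Rightarrow> nat \<Rightarrow> 'a \<Rightarrow> real" where
  "max_birkhoff T g 0 = (\<lambda>x. 0)"
| "max_birkhoff T g (Suc n) = (\<lambda>x. max 0 (g x + max_birkhoff T g n (T x)))"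

lemma max_birkhoff_nonneg: "max_birkhoff T g n x \<ge> 0"
  by (cases n) auto

lemma max_birkhoff_mono: "max_birkhoff T g n x \<le> max_birkhoff T g (Suc n) x"
proof (induction n arbitrary: x)
  case (Suc n)
  show ?case using Suc[of "T x"] by (auto simp: max_def)
qed simp

lemma birkhoff_sum_le_max_birkhoff: "birkhoff_sum T g n x \<le> max_birkhoff T g n x"
  by (induction n arbitrary: x) (auto simp: birkhoff_sum_Suc intro: max.coboundedI2)

context
  fixes M :: "'a measure" and T :: "'a \<Rightarrow> 'a"
  assumes T [measurable]: "T \<in> M \<rightarrow>\<^sub>M M" and invariant: "distr M M T = M"
begin

lemma integrable_comp_invariant:
  fixes f :: "'a \<Rightarrow> real"
  assumes "integrable M f"
  shows "integrable M (\<lambda>x. f (T x))" "(\<integral>x. f (T x) \<partial>M) = integral\<^sup>L M f"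
proof -
  have f: "f \<in> borel_measurable M" using assms by simp
  show "integrable M (\<lambda>x. f (T x))"
    using integrable_distr_eq[OF T f] assms invariant by simp
  show "(\<integral>x. f (T x) \<partial>M) = integral\<^sup>L M f"
    using integral_distr[OF T f] invariant by simp
qed

lemma integrable_max_birkhoff:
  assumes "integrable M g"
  shows "integrable M (max_birkhoff T g n)"
proof (induction n)
  case (Suc n)
  show ?case using assms integrable_comp_invariant(1)[OF Suc] by simp
qed simp

lemma birkhoff_sum_measurable [measurable]:
  assumes [measurable]: "g \<in> borel_measurable M"
  shows "birkhoff_sum T g n \<in> borel_measurable M"
  unfolding birkhoff_sum_def by measurable

text \<open>Garsia's argument. Where the maximum F is positive it equals \<open>g\<close> plus the
  previous maximum at T x, hence F - F o T \<le> g; elsewhere F = 0 and F o T \<ge> 0. So F - F o T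
  is bounded by \<open>g\<close> restricted to the positivity set, while its integral vanishes by
  invariance.\<close>

lemma maximal_ergodic_inequality:
  assumes g: "integrable M g"
  shows "0 \<le> (\<integral>x. indicator {x \<in> space M. 0 < max_birkhoff T g n x} x * g x \<partial>M)"
proof (cases n)
  case (Suc m)
  let ?F = "max_birkhoff T g n"
  let ?A = "{x \<in> space M. 0 < ?F x}"
  note F = integrable_max_birkhoff[OF g, of n]
  note FT = integrable_comp_invariant[OF F]
  have [measurable]: "?F \<in> borel_measurable M" using F by simp
  have A: "?A \<in> sets M" by measurable
  have int: "integrable M (\<lambda>x. indicator ?A x * g x)"
    using integrable_mult_indicator[OF A g] by simp
  have "0 = (\<integral>x. ?F x - ?F (T x) \<partial>M)" using F FT by simp
  also have "\<dots> \<le> (\<integral>x. indicator ?A x * g x \<partial>M)"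
  proof (rule integral_mono[OF _ int])
    show "integrable M (\<lambda>x. ?F x - ?F (T x))" using F FT by simp
    fix x assume x: "x \<in> space M"
    have "max_birkhoff T g m (T x) \<le> ?F (T x)" using max_birkhoff_mono[of T g m "T x"] Suc by simp
    then have "?F x - ?F (T x) \<le> g x" if "0 < ?F x" using that Suc by (auto simp: max_def split: if_splits)
    moreover have "0 \<le> ?F (T x)" by (rule max_birkhoff_nonneg)
    ultimately show "?F x - ?F (T x) \<le> indicator ?A x * g x"
      using x by (auto simp: indicator_def not_less)
  qed
  finally show ?thesis .
qed simp

text \<open>The maximal inequality for g - c bounds c times the measure of the set where some sum of
  length at most n exceeds its linear bound by the integral of \<open>g\<close> over that set. Thus
  these increasing sets have measure at most (integral of g) / c < 1, and so has their
  union.\<close>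

lemma birkhoff_sum_linear_bound_positive:
  assumes prob: "prob_space M" and g: "integrable M g" and c: "integral\<^sup>L M g < c" "0 < c"
    and nonneg: "\<And>x. 0 \<le> g x"
  shows "0 < measure M {x \<in> space M. \<forall>n. birkhoff_sum T g n x \<le> c * n}"
proof -
  interpret prob_space M by fact
  let ?h = "\<lambda>x. g x - c"
  have h: "integrable M ?h" using g by simp
  define A where "A = (\<lambda>n. {x \<in> space M. 0 < max_birkhoff T ?h n x})"
  have A [measurable]: "A n \<in> sets M" for n
    unfolding A_def using integrable_max_birkhoff[OF h, of n] by simp
  have le: "measure M (A n) \<le> integral\<^sup>L M g / c" for n
  proof -
    have iA: "integrable M (\<lambda>x. indicator (A n) x * g x)"
      using integrable_mult_indicator[OF A g] by simp
    have "0 \<le> (\<integral>x. indicator (A n) x * ?h x \<partial>M)"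
      using maximal_ergodic_inequality[OF h] unfolding A_def .
    also have "\<dots> = (\<integral>x. indicator (A n) x * g x - c * indicator (A n) x \<partial>M)"
      by (intro Bochner_Integration.integral_cong) (auto simp: algebra_simps)
    also have "\<dots> = (\<integral>x. indicator (A n) x * g x \<partial>M) - c * measure M (A n)"
      using iA by (subst Bochner_Integration.integral_diff) (auto simp: emeasure_eq_measure)
    also have "(\<integral>x. indicator (A n) x * g x \<partial>M) \<le> integral\<^sup>L M g"
      using nonneg by (intro integral_mono iA g) (auto simp: indicator_def)
    finally show ?thesis using c by (simp add: field_simps)
  qed
  have "incseq A"
    unfolding A_def incseq_Suc_iff
    by (auto simp del: max_birkhoff.simps intro: less_le_trans[OF _ max_birkhoff_mono])
  then have "(\<lambda>n. measure M (A n)) \<longlonglongrightarrow> measure M (\<Union>n. A n)"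
    by (intro finite_Lim_measure_incseq) auto
  then have "measure M (\<Union>n. A n) \<le> integral\<^sup>L M g / c"
    by (rule LIMSEQ_le_const2) (use le in auto)
  also have "\<dots> < 1" using c by simp
  finally have "0 < measure M (space M - (\<Union>n. A n))"
    by (subst prob_compl) auto
  also have "\<dots> \<le> measure M {x \<in> space M. \<forall>n. birkhoff_sum T g n x \<le> c * n}"
  proof (rule finite_measure_mono)
    show "space M - (\<Union>n. A n) \<subseteq> {x \<in> space M. \<forall>n. birkhoff_sum T g n x \<le> c * n}"
    proof clarsimp
      fix x n assume "x \<in> space M" "\<forall>n. x \<notin> A n"
      then have "max_birkhoff T ?h n x \<le> 0" by (auto simp: A_def not_less)
      then show "birkhoff_sum T g n x \<le> c * n"
        using birkhoff_sum_le_max_birkhoff[of T ?h n x] by (simp add: birkhoff_sum_diff_const)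
    qed
    have [measurable]: "g \<in> borel_measurable M" using g by simp
    show "{x \<in> space M. \<forall>n. birkhoff_sum T g n x \<le> c * n} \<in> sets M" by measurable
  qed
  finally show ?thesis .
qed

text \<open>Adding or dropping the first term of the sums changes only the additive constant, so the
  set of points with such a bound is exactly invariant. It has positive measure by the previous
  lemma, and ergodicity makes the measure 1.\<close>

lemma ergodic_birkhoff_sum_linear_bound:
  assumes prob: "prob_space M" and g: "integrable M g" and nonneg: "\<And>x. 0 \<le> g x"
    and ergodic: "\<And>B. B \<in> sets M \<Longrightarrow> T -` B \<inter> space M = B \<Longrightarrow> measure M B = 0 \<or> measure M B = 1"
    and c: "integral\<^sup>L M g < c" "0 < c"
  shows "AE x in M. \<exists>C. \<forall>n. birkhoff_sum T g n x \<le> c * n + C"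
proof -
  interpret prob_space M by fact
  have [measurable]: "g \<in> borel_measurable M" using g by simp
  \<comment> \<open>Restricting \<open>C\<close> to natural numbers makes this a countable union,
    hence measurable.\<close>
  define B where "B = {x \<in> space M. \<exists>C::nat. \<forall>n. birkhoff_sum T g n x \<le> c * n + C}"
  have B [measurable]: "B \<in> sets M" unfolding B_def by measurable
  have ceil: "C \<le> real (nat \<lceil>C\<rceil>)" for C by linarith
  have "T -` B \<inter> space M = B"
  proof (intro set_eqI iffI)
    fix x assume "x \<in> T -` B \<inter> space M"
    then obtain C where x: "x \<in> space M" and C: "\<And>n. birkhoff_sum T g n (T x) \<le> c * n + real C"
      by (auto simp: B_def)
    have *: "birkhoff_sum T g n x \<le> c * n + (g x + C)" for n
    proof (cases n)
      case (Suc m)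
      then show ?thesis using C[of m] c by (simp add: birkhoff_sum_Suc algebra_simps)
    qed (use nonneg[of x] in simp)
    have "birkhoff_sum T g n x \<le> c * n + real (nat \<lceil>g x + C\<rceil>)" for n
      using *[of n] ceil[of "g x + C"] by linarith
    then show "x \<in> B" using x unfolding B_def by blast
  next
    fix x assume "x \<in> B"
    then obtain C where x: "x \<in> space M" and C: "\<And>n. birkhoff_sum T g n x \<le> c * n + real C"
      by (auto simp: B_def)
    \<comment> \<open>The sum of length n at T x is the sum of length n + 1 at x without the
      nonnegative first term; the extra step costs \<open>c\<close>.\<close>
    have *: "birkhoff_sum T g n (T x) \<le> c * n + (c + C)" for n
      using C[of "Suc n"] nonneg[of x] by (simp add: birkhoff_sum_Suc algebra_simps)
    have "birkhoff_sum T g n (T x) \<le> c * n + real (nat \<lceil>c + C\<rceil>)" for n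
      using *[of n] ceil[of "c + C"] by linarith
    moreover have "T x \<in> space M" using x T by (rule measurable_space[rotated])
    ultimately show "x \<in> T -` B \<inter> space M" using x unfolding B_def by blast
  qed
  moreover have "0 < measure M B"
  proof -
    have "{x \<in> space M. \<forall>n. birkhoff_sum T g n x \<le> c * n} \<subseteq> B"
      unfolding B_def by (auto intro!: exI[of _ 0])
    then show ?thesis
      using less_le_trans[OF birkhoff_sum_linear_bound_positive[OF prob g c nonneg]
          finite_measure_mono[OF _ B]] by blast
  qed
  ultimately have "measure M B = 1" using ergodic[OF B] by auto
  then have "AE x in M. x \<in> B" by (simp add: prob_eq_1)
  then show ?thesis by eventually_elim (auto simp: B_def)
qed

end

section \<open>Compositions along paths\<close>

text \<open>The words below are only required to match at the vertices, the incidence matrix plays no role.\<close>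

fun path_word :: "('v, 'e, 'a, 'm) gdms_scheme \<Rightarrow> 'v \<Rightarrow> 'e list \<Rightarrow> 'v \<Rightarrow> bool" where
  "path_word S v [] u \<longleftrightarrow> v \<in> verts S \<and> u = v"
| "path_word S v (e # w) u \<longleftrightarrow> e \<in> edges S \<and> ivert S e = v \<and> path_word S (tvert S e) w u"

lemma path_word_append:
  "path_word S v w u \<Longrightarrow> path_word S u w' t \<Longrightarrow> path_word S v (w @ w') t"
  by (induction w arbitrary: v) auto

lemma path_word_last: "path_word S v w u \<Longrightarrow> w \<noteq> [] \<Longrightarrow> u = tvert S (last w)"
  by (induction w arbitrary: v) (auto split: if_splits elim: path_word.elims)

lemma word_map_Nil [simp]: "word_map S [] = id"
  and word_map_Cons [simp]: "word_map S (e # w) = fmap S e \<circ> word_map S w"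
  by (simp_all add: word_map_def)

lemma word_map_append: "word_map S (w @ w') = word_map S w \<circ> word_map S w'"
  by (induction w) (auto simp: comp_assoc)

lemma funpow_shift: "(shift ^^ n) \<omega> = (\<lambda>k. \<omega> (n + k))"
  by (induction n) (auto simp: shift_def)

lemma map_upt_Suc_shift: "map \<omega> [0..<Suc n] = \<omega> 0 # map (shift \<omega>) [0..<n]"
  by (simp add: map_upt_Suc shift_def del: upt_Suc)

lemma shift_in_inf_words: "\<omega> \<in> inf_words S \<Longrightarrow> shift \<omega> \<in> inf_words S"
  by (simp add: inf_words_def shift_def)

lemma funpow_shift_in_inf_words: "\<omega> \<in> inf_words S \<Longrightarrow> (shift ^^ n) \<omega> \<in> inf_words S"
  by (induction n) (auto simp: shift_in_inf_words)

lemma prefix_in_fin_words: "\<omega> \<in> inf_words S \<Longrightarrow> map \<omega> [0..<n] \<in> fin_words S"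
  by (auto simp: fin_words_def inf_words_def successively_conv_nth)

section \<open>Consequences of the axioms for generators and their compositions\<close>

locale conformal_system =
  fixes S :: "('v, 'e, 'a::euclidean_space, 'm) cgdms_scheme"
  assumes conformal: "conformal_gdms S" and nbhds: "compact_neighbourhoods S"
begin

lemma gdms: "is_gdms S"
  using conformal by (simp add: conformal_gdms_def)

lemma finite_verts: "finite (verts S)" and countable_edges: "countable (edges S)"
  using gdms by (simp_all add: is_gdms_def)

lemma ivert_in: "e \<in> edges S \<Longrightarrow> ivert S e \<in> verts S"
  and tvert_in: "e \<in> edges S \<Longrightarrow> tvert S e \<in> verts S"
  using gdms by (simp_all add: is_gdms_def)

lemma tvert_eq_ivert: "a \<in> edges S \<Longrightarrow> b \<in> edges S \<Longrightarrow> incid S a b \<Longrightarrow> tvert S a = ivert S b"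
  using gdms by (simp add: is_gdms_def)

lemma xset_nonempty: "v \<in> verts S \<Longrightarrow> xset S v \<noteq> {}"
  and xset_compact: "v \<in> verts S \<Longrightarrow> compact (xset S v)"
  and xset_connected: "v \<in> verts S \<Longrightarrow> connected (xset S v)"
  and xset_regular: "v \<in> verts S \<Longrightarrow> xset S v = closure (interior (xset S v))"
  and wset_open: "v \<in> verts S \<Longrightarrow> open (wset S v)"
  and xset_subset_wset: "v \<in> verts S \<Longrightarrow> xset S v \<subseteq> wset S v"
  using conformal unfolding conformal_gdms_def is_gdms_def by blast+

lemma sset_subset_wset: "v \<in> verts S \<Longrightarrow> sset S v \<subseteq> wset S v"
  and xset_subset_interior_sset: "v \<in> verts S \<Longrightarrow> xset S v \<subseteq> interior (sset S v)"
  using nbhds unfolding compact_neighbourhoods_def by blast+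

lemma xset_subset_sset: "v \<in> verts S \<Longrightarrow> xset S v \<subseteq> sset S v"
  using xset_subset_interior_sset interior_subset by blast

lemma fmap_xset: "e \<in> edges S \<Longrightarrow> x \<in> xset S (tvert S e) \<Longrightarrow> fmap S e x \<in> xset S (ivert S e)"
  using gdms unfolding is_gdms_def by blast

lemma fmap_inj: "e \<in> edges S \<Longrightarrow> inj_on (fmap S e) (wset S (tvert S e))"
  and fmap_wset: "e \<in> edges S \<Longrightarrow> fmap S e ` wset S (tvert S e) \<subseteq> wset S (ivert S e)"
  and fmap_C1: "e \<in> edges S \<Longrightarrow> C1_on (fmap S e) (wset S (tvert S e))"
  and fmap_conformal: "e \<in> edges S \<Longrightarrow> conformal_on (fmap S e) (wset S (tvert S e))"
  using conformal by (simp_all add: conformal_gdms_def C1_diffeo_into_def)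

lemma open_set_condition:
  "a \<in> edges S \<Longrightarrow> b \<in> edges S \<Longrightarrow> a \<noteq> b \<Longrightarrow>
     fmap S a ` interior (xset S (tvert S a)) \<inter> fmap S b ` interior (xset S (tvert S b)) = {}"
  using conformal by (simp add: conformal_gdms_def)

lemma fmap_derivative:
  assumes "e \<in> edges S" "p \<in> wset S (tvert S e)"
  shows "(fmap S e has_derivative frechet_derivative (fmap S e) (at p)) (at p)"
    and "linear_similarity (frechet_derivative (fmap S e) (at p))"
proof -
  show "(fmap S e has_derivative frechet_derivative (fmap S e) (at p)) (at p)"
    using fmap_C1[OF assms(1)] assms(2) unfolding C1_on_def
    by (metis frechet_derivative_at)
  show "linear_similarity (frechet_derivative (fmap S e) (at p))"
    using fmap_conformal[OF assms(1)] assms(2) by (simp add: conformal_on_def)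
qed

lemma path_word_verts:
  assumes "path_word S v w u"
  shows "v \<in> verts S" "u \<in> verts S"
  using assms by (induction w arbitrary: v) (auto simp: ivert_in)

lemma word_map_xset: "path_word S v w u \<Longrightarrow> x \<in> xset S u \<Longrightarrow> word_map S w x \<in> xset S v"
  by (induction w arbitrary: v) (auto simp: fmap_xset)

lemma word_map_wset: "path_word S v w u \<Longrightarrow> x \<in> wset S u \<Longrightarrow> word_map S w x \<in> wset S v"
proof (induction w arbitrary: v)
  case (Cons e w)
  then show ?case using fmap_wset[of e] by auto
qed auto

lemma word_map_inj: "path_word S v w u \<Longrightarrow> inj_on (word_map S w) (wset S u)"
proof (induction w arbitrary: v)
  case (Cons e w)
  then have "inj_on (fmap S e) (word_map S w ` wset S u)" "inj_on (word_map S w) (wset S u)"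
    using word_map_wset by (auto intro: inj_on_subset[OF fmap_inj])
  then show ?case unfolding word_map_Cons by (intro comp_inj_on)
qed auto

lemma word_map_derivative:
  assumes "path_word S v w u" "p \<in> wset S u"
  shows "(word_map S w has_derivative frechet_derivative (word_map S w) (at p)) (at p) \<and>
    linear_similarity (frechet_derivative (word_map S w) (at p))"
  using assms(1)
proof (induction w arbitrary: v)
  case Nil
  have "linear_similarity (\<lambda>x::'a. x)" by (auto simp: linear_similarity_def intro!: exI[of _ 1] linear_id[unfolded id_def])
  moreover have "(word_map S [] has_derivative (\<lambda>x. x)) (at p)" by (simp add: id_def)
  ultimately show ?case using frechet_derivative_at by metis
next
  case (Cons e w)
  let ?D = "frechet_derivative (fmap S e) (at (word_map S w p)) \<circ> frechet_derivative (word_map S w) (at p)"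
  have e: "e \<in> edges S" and w: "path_word S (tvert S e) w u" using Cons.prems by auto
  note q = word_map_wset[OF w assms(2)]
  have "(word_map S (e # w) has_derivative ?D) (at p)"
    using Cons.IH[OF w] fmap_derivative(1)[OF e q] by (auto intro: diff_chain_at)
  moreover have "linear_similarity ?D"
    using Cons.IH[OF w] fmap_derivative(2)[OF e q] by (auto intro: linear_similarity_comp)
  ultimately show ?case using frechet_derivative_at by metis
qed

text \<open>The chain rule becomes an equality of norms because both derivatives are similarities.
  This lets logarithms of derivative norms be written as Birkhoff sums.\<close>

lemma deriv_norm_Cons:
  assumes e: "e \<in> edges S" and w: "path_word S (tvert S e) w u" and p: "p \<in> wset S u"
  shows "deriv_norm (word_map S (e # w)) p =
    deriv_norm (fmap S e) (word_map S w p) * deriv_norm (word_map S w) p"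
proof -
  note q = word_map_wset[OF w p]
  have "(word_map S (e # w) has_derivative
      frechet_derivative (fmap S e) (at (word_map S w p)) \<circ> frechet_derivative (word_map S w) (at p)) (at p)"
    using word_map_derivative[OF w p] fmap_derivative(1)[OF e q] by (auto intro: diff_chain_at)
  then have "frechet_derivative (word_map S (e # w)) (at p) =
      frechet_derivative (fmap S e) (at (word_map S w p)) \<circ> frechet_derivative (word_map S w) (at p)"
    by (rule frechet_derivative_at[symmetric])
  then show ?thesis
    using word_map_derivative[OF w p] fmap_derivative(2)[OF e q]
    unfolding deriv_norm_def by (simp add: linear_similarity_onorm_comp)
qed

lemma deriv_norm_pos:
  assumes "path_word S v w u" "p \<in> wset S u"
  shows "deriv_norm (word_map S w) p > 0"
  using word_map_derivative[OF assms] linear_similarity_onorm(1) unfolding deriv_norm_def by blast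

lemma fmap_deriv_norm_pos:
  assumes "e \<in> edges S" "p \<in> wset S (tvert S e)"
  shows "deriv_norm (fmap S e) p > 0"
  using fmap_derivative(2)[OF assms] linear_similarity_onorm(1) unfolding deriv_norm_def by blast

lemma word_map_continuous: "path_word S v w u \<Longrightarrow> continuous_on (wset S u) (word_map S w)"
  by (intro continuous_at_imp_continuous_on ballI
      has_derivative_continuous[OF word_map_derivative[THEN conjunct1]])

lemma word_map_open:
  assumes "path_word S v w u" "open U" "U \<subseteq> wset S u"
  shows "open (word_map S w ` U)"
  using invariance_of_domain[OF continuous_on_subset[OF word_map_continuous assms(3)] assms(2)
      inj_on_subset[OF word_map_inj assms(3)]] assms(1) by blast

text \<open>By invariance of domain the image is open, and it lies in the set at the initial
  vertex.\<close>

lemma word_map_interior: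
  assumes "path_word S v w u"
  shows "word_map S w ` interior (xset S u) \<subseteq> interior (xset S v)"
proof (rule interior_maximal)
  show "word_map S w ` interior (xset S u) \<subseteq> xset S v"
    using word_map_xset[OF assms] interior_subset by blast
  show "open (word_map S w ` interior (xset S u))"
    using xset_subset_wset[OF path_word_verts(2)[OF assms]] interior_subset
    by (intro word_map_open[OF assms]) auto
qed

section \<open>Uniform contraction on the sets at the vertices\<close>

definition contraction_ratio :: real where
  "contraction_ratio =
     (SOME s. 0 < s \<and> s < 1 \<and> (\<forall>e\<in>edges S. s-lipschitz_on (xset S (tvert S e)) (fmap S e)))"

lemma contraction_ratio: "0 < contraction_ratio" "contraction_ratio < 1"
  and fmap_lipschitz: "e \<in> edges S \<Longrightarrow> contraction_ratio-lipschitz_on (xset S (tvert S e)) (fmap S e)"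
proof -
  have "\<exists>s. 0 < s \<and> s < 1 \<and> (\<forall>e\<in>edges S. s-lipschitz_on (xset S (tvert S e)) (fmap S e))"
    using gdms unfolding is_gdms_def by blast
  from someI_ex[OF this] show "0 < contraction_ratio" "contraction_ratio < 1"
    and "e \<in> edges S \<Longrightarrow> contraction_ratio-lipschitz_on (xset S (tvert S e)) (fmap S e)"
    unfolding contraction_ratio_def by blast+
qed

lemma word_map_lipschitz:
  assumes "path_word S v w u" "p \<in> xset S u" "q \<in> xset S u"
  shows "dist (word_map S w p) (word_map S w q) \<le> contraction_ratio ^ length w * dist p q"
  using assms(1)
proof (induction w arbitrary: v)
  case (Cons e w)
  then have e: "e \<in> edges S" and w: "path_word S (tvert S e) w u" by auto
  have "dist (word_map S (e # w) p) (word_map S (e # w) q)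
      \<le> contraction_ratio * dist (word_map S w p) (word_map S w q)"
    using lipschitz_onD[OF fmap_lipschitz[OF e] word_map_xset[OF w] word_map_xset[OF w]] assms by simp
  also have "\<dots> \<le> contraction_ratio * (contraction_ratio ^ length w * dist p q)"
    using Cons.IH[OF w] contraction_ratio by (intro mult_left_mono) auto
  finally show ?case by (simp add: mult.assoc)
qed simp

section \<open>The coding map\<close>

lemma path_word_prefix:
  assumes "\<omega> \<in> inf_words S"
  shows "path_word S (ivert S (\<omega> 0)) (map \<omega> [0..<n]) (ivert S (\<omega> n))"
  using assms
proof (induction n arbitrary: \<omega>)
  case 0
  then show ?case by (simp add: inf_words_def ivert_in)
next
  case (Suc n)
  have "ivert S (shift \<omega> 0) = tvert S (\<omega> 0)" "\<omega> 0 \<in> edges S"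
    using Suc.prems tvert_eq_ivert[of "\<omega> 0" "\<omega> 1"] by (auto simp: shift_def inf_words_def)
  then show ?case
    using Suc.IH[OF shift_in_inf_words[OF Suc.prems]]
    unfolding map_upt_Suc_shift by (simp add: shift_def)
qed

text \<open>The domain is taken at the initial vertex of the next letter. By admissibility this is
  the terminal vertex of the last letter used, and the form also makes sense for n = 0, where it
  gives the whole set at the initial vertex of \<omega>.\<close>

definition cylinder_image :: "(nat \<Rightarrow> 'e) \<Rightarrow> nat \<Rightarrow> 'a set" where
  "cylinder_image \<omega> n = word_map S (map \<omega> [0..<n]) ` xset S (ivert S (\<omega> n))"

lemma tvert_eq_ivert_Suc: "\<omega> \<in> inf_words S \<Longrightarrow> tvert S (\<omega> n) = ivert S (\<omega> (Suc n))"
  by (simp add: inf_words_def tvert_eq_ivert)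

lemma cylinder_image_Suc_subset:
  assumes "\<omega> \<in> inf_words S"
  shows "cylinder_image \<omega> (Suc n) \<subseteq> cylinder_image \<omega> n"
proof -
  have "\<omega> n \<in> edges S" using assms by (simp add: inf_words_def)
  then show ?thesis
    using fmap_xset[of "\<omega> n"] tvert_eq_ivert_Suc[OF assms, of n]
    unfolding cylinder_image_def by (auto simp: word_map_append)
qed

lemma cylinder_image_compact:
  assumes "\<omega> \<in> inf_words S"
  shows "compact (cylinder_image \<omega> n)" "cylinder_image \<omega> n \<noteq> {}"
proof -
  note path = path_word_prefix[OF assms, of n]
  note v = path_word_verts(2)[OF path]
  show "compact (cylinder_image \<omega> n)"
    unfolding cylinder_image_def
    by (rule compact_continuous_image[OF continuous_on_subset[OF word_map_continuous[OF path]
          xset_subset_wset[OF v]] xset_compact[OF v]])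
  show "cylinder_image \<omega> n \<noteq> {}"
    unfolding cylinder_image_def using xset_nonempty[OF v] by simp
qed

lemma xset_diameter_bound: "\<exists>D. \<forall>v\<in>verts S. \<forall>p\<in>xset S v. \<forall>q\<in>xset S v. dist p q \<le> D"
proof -
  have "bounded (\<Union>v\<in>verts S. xset S v)"
    using finite_verts xset_compact compact_imp_bounded by auto
  then obtain D where "\<And>x y. x \<in> (\<Union>v\<in>verts S. xset S v) \<Longrightarrow> y \<in> (\<Union>v\<in>verts S. xset S v) \<Longrightarrow> dist x y \<le> D"
    unfolding bounded_two_points by blast
  then show ?thesis by blast
qed

text \<open>The finitely many compact sets have a common diameter bound, and n generators shrink it
  by the n-th power of the contraction ratio. Uniformity in \<omega> is what yields continuity of
  the coding map.\<close>

lemma cylinder_images_uniformly_small: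
  assumes "\<epsilon> > 0"
  shows "\<exists>n. \<forall>\<omega>\<in>inf_words S. \<forall>x\<in>cylinder_image \<omega> n. \<forall>y\<in>cylinder_image \<omega> n. dist x y < \<epsilon>"
proof -
  obtain D where D: "\<And>v p q. v \<in> verts S \<Longrightarrow> p \<in> xset S v \<Longrightarrow> q \<in> xset S v \<Longrightarrow> dist p q \<le> D"
    using xset_diameter_bound by blast
  have "(\<lambda>n. contraction_ratio ^ n * D) \<longlonglongrightarrow> 0 * D"
    using contraction_ratio by (intro tendsto_intros LIMSEQ_realpow_zero) auto
  then have "\<forall>\<^sub>F n in sequentially. contraction_ratio ^ n * D < \<epsilon>"
    using assms by (intro order_tendstoD) auto
  then obtain n where n: "contraction_ratio ^ n * D < \<epsilon>" by (auto simp: eventually_sequentially)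
  have "dist x y < \<epsilon>" if \<omega>: "\<omega> \<in> inf_words S" and xy: "x \<in> cylinder_image \<omega> n" "y \<in> cylinder_image \<omega> n" for \<omega> x y
  proof -
    note path = path_word_prefix[OF \<omega>, of n]
    obtain p q where pq: "p \<in> xset S (ivert S (\<omega> n))" "q \<in> xset S (ivert S (\<omega> n))"
        "x = word_map S (map \<omega> [0..<n]) p" "y = word_map S (map \<omega> [0..<n]) q"
      using xy by (auto simp: cylinder_image_def)
    have "dist x y \<le> contraction_ratio ^ n * dist p q"
      using word_map_lipschitz[OF path pq(1,2)] pq by simp
    also have "\<dots> \<le> contraction_ratio ^ n * D"
      using D[OF path_word_verts(2)[OF path] pq(1,2)] contraction_ratio by (intro mult_left_mono) auto
    finally show ?thesis using n by simp
  qed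
  then show ?thesis by blast
qed

lemma cylinder_image_point_unique:
  assumes "\<omega> \<in> inf_words S" "\<And>n. x \<in> cylinder_image \<omega> (Suc n)" "\<And>n. y \<in> cylinder_image \<omega> (Suc n)"
  shows "x = y"
proof (rule ccontr)
  assume "x \<noteq> y"
  then have "0 < dist x y" by simp
  from cylinder_images_uniformly_small[OF this] obtain n where
    "\<forall>a\<in>cylinder_image \<omega> n. \<forall>b\<in>cylinder_image \<omega> n. dist a b < dist x y"
    using assms(1) by blast
  moreover have "x \<in> cylinder_image \<omega> n" "y \<in> cylinder_image \<omega> n"
    using assms cylinder_image_Suc_subset[OF assms(1), of n] by blast+
  ultimately show False by blast
qed

lemma coding_map_eqI:
  assumes "\<omega> \<in> inf_words S" "\<And>n. x \<in> cylinder_image \<omega> (Suc n)"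
  shows "coding_map S \<omega> = x"
proof -
  have eq: "(\<Inter>n\<in>{1..}. word_map S (map \<omega> [0..<n]) ` xset S (tvert S (\<omega> (n - 1)))) =
      (\<Inter>n. cylinder_image \<omega> (Suc n))"
  proof -
    have "{1..} = range Suc" by (auto simp: image_iff) (metis Suc_le_D)
    then show ?thesis
      unfolding cylinder_image_def using tvert_eq_ivert_Suc[OF assms(1)] by (simp del: upt_Suc)
  qed
  show ?thesis unfolding coding_map_def eq
    using assms cylinder_image_point_unique[OF assms(1)] by (intro the_equality) auto
qed

text \<open>The cylinder images are nested nonempty compact sets, so they share a point, which
  uniqueness identifies with the value of the coding map.\<close>

lemma coding_map_in_cylinder_image:
  assumes "\<omega> \<in> inf_words S"
  shows "coding_map S \<omega> \<in> cylinder_image \<omega> n"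
proof -
  have "cylinder_image \<omega> n \<subseteq> cylinder_image \<omega> m" if "m \<le> n" for m n
    using lift_Suc_antimono_le[of "cylinder_image \<omega>", OF cylinder_image_Suc_subset[OF assms] that] .
  then have "\<Inter>(range (cylinder_image \<omega>)) \<noteq> {}"
    using cylinder_image_compact[OF assms] by (intro compact_nest)
  then obtain x where "\<And>n. x \<in> cylinder_image \<omega> n" by auto
  then show ?thesis using coding_map_eqI[OF assms] by metis
qed

lemma coding_map_in_xset: "\<omega> \<in> inf_words S \<Longrightarrow> coding_map S \<omega> \<in> xset S (ivert S (\<omega> 0))"
  using coding_map_in_cylinder_image[of \<omega> 0] by (simp add: cylinder_image_def)

text \<open>The first generator carries the n-th cylinder image of the shifted word to the (n+1)-st
  of the word itself, so the right-hand side lies in all sets that determine the coded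
  point.\<close>

lemma coding_map_shift:
  assumes "\<omega> \<in> inf_words S"
  shows "coding_map S \<omega> = fmap S (\<omega> 0) (coding_map S (shift \<omega>))"
proof (rule coding_map_eqI[OF assms])
  fix n
  have "coding_map S (shift \<omega>) \<in> cylinder_image (shift \<omega>) n"
    using coding_map_in_cylinder_image shift_in_inf_words[OF assms] by blast
  then show "fmap S (\<omega> 0) (coding_map S (shift \<omega>)) \<in> cylinder_image \<omega> (Suc n)"
    unfolding cylinder_image_def map_upt_Suc_shift by (auto simp: shift_def)
qed

lemma coding_map_prefix:
  assumes "\<omega> \<in> inf_words S"
  shows "coding_map S \<omega> = word_map S (map \<omega> [0..<n]) (coding_map S ((shift ^^ n) \<omega>))"
  using assms
proof (induction n arbitrary: \<omega>)
  case (Suc n)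
  show ?case
    using coding_map_shift[OF Suc.prems] Suc.IH[OF shift_in_inf_words[OF Suc.prems]]
    unfolding map_upt_Suc_shift by (simp add: funpow_swap1)
qed simp

section \<open>Holes\<close>

definition first_level :: "'a set" where
  "first_level = (\<Union>e\<in>edges S. fmap S e ` xset S (tvert S e))"

lemma coding_map_in_first_level:
  assumes "\<omega> \<in> inf_words S"
  shows "coding_map S \<omega> \<in> first_level"
proof -
  have "coding_map S (shift \<omega>) \<in> xset S (tvert S (\<omega> 0))"
    using coding_map_in_xset[OF shift_in_inf_words[OF assms]] tvert_eq_ivert_Suc[OF assms, of 0]
    by (simp add: shift_def)
  then show ?thesis
    using assms coding_map_shift[OF assms] unfolding first_level_def by (auto simp: inf_words_def)
qed

text \<open>The image of the interior under one generator is open, so it misses not only the images of the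
  interiors under the others but also their closures.\<close>

lemma fmap_interior_disjoint:
  assumes "a \<in> edges S" "b \<in> edges S" "a \<noteq> b"
  shows "fmap S a ` interior (xset S (tvert S a)) \<inter> fmap S b ` xset S (tvert S b) = {}"
proof -
  let ?A = "fmap S a ` interior (xset S (tvert S a))"
  have path: "path_word S (ivert S e) [e] (tvert S e)" if "e \<in> edges S" for e
    using that tvert_in by simp
  have "open ?A"
    using word_map_open[OF path[OF assms(1)], of "interior (xset S (tvert S a))"]
      xset_subset_wset[OF tvert_in[OF assms(1)]] interior_subset by fastforce
  moreover have "?A \<inter> fmap S b ` interior (xset S (tvert S b)) = {}"
    using open_set_condition assms by blast
  ultimately have "?A \<inter> closure (fmap S b ` interior (xset S (tvert S b))) = {}"
    by (simp add: open_Int_closure_eq_empty)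
  moreover have "fmap S b ` xset S (tvert S b) \<subseteq> closure (fmap S b ` interior (xset S (tvert S b)))"
  proof -
    note reg = xset_regular[OF tvert_in[OF assms(2)]]
    have "continuous_on (xset S (tvert S b)) (fmap S b)"
      using continuous_on_subset[OF word_map_continuous[OF path[OF assms(2)]]
          xset_subset_wset[OF tvert_in[OF assms(2)]]] by simp
    then have "continuous_on (closure (interior (xset S (tvert S b)))) (fmap S b)"
      using reg by simp
    from image_closure_subset[OF this closed_closure closure_subset] show ?thesis
      using reg by simp
  qed
  ultimately show ?thesis by blast
qed

text \<open>Induction on the word, comparing its first letter with that of \<omega>. If they agree,
  injectivity cancels the generator and the word and \<omega> are both shortened; if they differ,
  the open set condition in its strengthened form separates the points. For the empty word, the hole
  misses the first-level images, which contain every coded point.\<close>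

lemma hole_image_disjoint_limit_set:
  assumes U: "U \<subseteq> interior (xset S u)" "U \<inter> first_level = {}" and w: "path_word S v w u"
  shows "word_map S w ` U \<inter> limit_set S = {}"
proof -
  have "word_map S w z \<noteq> coding_map S \<omega>" if "z \<in> U" "\<omega> \<in> inf_words S" for z \<omega>
    using w that
  proof (induction w arbitrary: v \<omega>)
    case Nil
    then show ?case using coding_map_in_first_level[of \<omega>] U(2) by auto
  next
    case (Cons a w)
    then have a: "a \<in> edges S" and w: "path_word S (tvert S a) w u" by auto
    let ?x = "coding_map S (shift \<omega>)"
    have b: "\<omega> 0 \<in> edges S" using Cons.prems by (simp add: inf_words_def)
    have x: "?x \<in> xset S (tvert S (\<omega> 0))"
      using coding_map_in_xset[OF shift_in_inf_words[OF Cons.prems(3)]] tvert_eq_ivert_Suc[OF Cons.prems(3), of 0]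
      by (simp add: shift_def)
    have int: "word_map S w z \<in> interior (xset S (tvert S a))"
      using word_map_interior[OF w] Cons.prems(2) U(1) by blast
    show ?case
    proof (cases "a = \<omega> 0")
      case True
      have "word_map S w z \<noteq> ?x"
        using Cons.IH[OF w Cons.prems(2) shift_in_inf_words[OF Cons.prems(3)]] .
      moreover have "word_map S w z \<in> wset S (tvert S a)" "?x \<in> wset S (tvert S a)"
        using int x True interior_subset xset_subset_wset[OF tvert_in[OF a]] by blast+
      ultimately have "fmap S a (word_map S w z) \<noteq> fmap S a ?x"
        using inj_onD[OF fmap_inj[OF a]] by blast
      then show ?thesis using coding_map_shift[OF Cons.prems(3)] True by simp
    next
      case False
      have "fmap S a (word_map S w z) \<in> fmap S a ` interior (xset S (tvert S a))"
        using int by blast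
      moreover have "fmap S (\<omega> 0) ?x \<in> fmap S (\<omega> 0) ` xset S (tvert S (\<omega> 0))" using x by blast
      ultimately have "fmap S a (word_map S w z) \<noteq> fmap S (\<omega> 0) ?x"
        using fmap_interior_disjoint[OF a b False] by (metis disjoint_iff)
      then show ?thesis using coding_map_shift[OF Cons.prems(3)] by simp
    qed
  qed
  then show ?thesis by (auto simp: limit_set_def)
qed

text \<open>Take edges \<open>a\<close> and \<open>b\<close> that terminate at \<open>v\<close> and
  \<open>u\<close>. In an admissible word from \<open>a\<close> to \<open>b\<close>, the part after
  \<open>a\<close> starts at \<open>v\<close> and ends at \<open>u\<close>.\<close>

lemma path_between_vertices:
  assumes "finitely_irreducible S" "v \<in> verts S" "u \<in> verts S"
  shows "\<exists>w. path_word S v w u"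
proof -
  have "\<forall>v\<in>verts S. \<exists>e\<in>edges S. tvert S e = v"
    using gdms unfolding is_gdms_def by blast
  then obtain a b where a: "a \<in> edges S" "tvert S a = v" and b: "b \<in> edges S" "tvert S b = u"
    using assms by metis
  obtain w where "[a] @ w @ [b] \<in> fin_words S"
    using assms(1) a b unfolding finitely_irreducible_def by blast
  moreover have "path_word S (tvert S a) (w @ [b]) (tvert S b)"
    if "a \<in> edges S" "[a] @ w @ [b] \<in> fin_words S" for a w
    using that
  proof (induction w arbitrary: a)
    case Nil
    then show ?case using tvert_eq_ivert b(1) by (auto simp: fin_words_def tvert_in)
  next
    case (Cons c w)
    then have "c \<in> edges S" "[c] @ w @ [b] \<in> fin_words S" "tvert S a = ivert S c"
      using tvert_eq_ivert by (auto simp: fin_words_def)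
    then show ?case using Cons.IH by simp
  qed
  ultimately show ?thesis using a b by blast
qed

text \<open>The open hole at one vertex is carried to every vertex by a connecting word. Its images
  under further words stay off the limit set, because they are images of the original hole under
  concatenated words. Finiteness of the vertex set gives a common radius.\<close>

lemma uniform_holes:
  assumes "finitely_irreducible S" "total_xset S - closure first_level \<noteq> {}"
  shows "\<exists>\<rho>>0. \<forall>u\<in>verts S. \<exists>z. cball z \<rho> \<subseteq> interior (xset S u) \<and>
    (\<forall>v w. path_word S v w u \<longrightarrow> word_map S w ` cball z \<rho> \<inter> limit_set S = {})"
proof -
  obtain y v0 where y: "v0 \<in> verts S" "y \<in> xset S v0" "y \<notin> closure first_level"
    using assms(2) by (auto simp: total_xset_def)
  define U where "U = interior (xset S v0) - closure first_level"
  have "open (- closure first_level)" by auto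
  \<comment> \<open>The complement of the closure is open and meets the closure of the interior (at
    \<open>y\<close>), so it meets the interior itself.\<close>
  then have "- closure first_level \<inter> closure (interior (xset S v0)) = {} \<longleftrightarrow>
      - closure first_level \<inter> interior (xset S v0) = {}"
    by (rule open_Int_closure_eq_empty)
  then have "U \<noteq> {}" using y xset_regular[OF y(1)] by (auto simp: U_def)
  have "open U" by (auto simp: U_def)
  have U: "U \<subseteq> interior (xset S v0)" "U \<inter> first_level = {}"
    using closure_subset[of first_level] by (auto simp: U_def)
  have "\<exists>\<rho>>0. \<exists>z. cball z \<rho> \<subseteq> interior (xset S u) \<and>
      (\<forall>v w. path_word S v w u \<longrightarrow> word_map S w ` cball z \<rho> \<inter> limit_set S = {})"
    if u: "u \<in> verts S" for u
  proof -
    obtain w where w: "path_word S u w v0" using path_between_vertices[OF assms(1) u y(1)] by blast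
    have "open (word_map S w ` U)"
      using \<open>open U\<close> U(1) interior_subset xset_subset_wset[OF y(1)] by (intro word_map_open[OF w]) auto
    moreover obtain z where "z \<in> word_map S w ` U" using \<open>U \<noteq> {}\<close> by blast
    ultimately obtain \<rho> where \<rho>: "\<rho> > 0" "cball z \<rho> \<subseteq> word_map S w ` U"
      unfolding open_contains_cball by blast
    have "cball z \<rho> \<subseteq> interior (xset S u)"
      using \<rho>(2) word_map_interior[OF w] U(1) by blast
    moreover have "word_map S w' ` cball z \<rho> \<inter> limit_set S = {}" if "path_word S v w' u" for v w'
    proof -
      have "word_map S w' ` cball z \<rho> \<subseteq> word_map S (w' @ w) ` U"
        using \<rho>(2) by (auto simp: word_map_append image_comp[symmetric])
      then show ?thesis
        using hole_image_disjoint_limit_set[OF U path_word_append[OF that w]] by blast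
    qed
    ultimately show ?thesis using \<rho>(1) by blast
  qed
  then obtain \<rho> where \<rho>: "\<And>u. u \<in> verts S \<Longrightarrow> \<rho> u > 0 \<and> (\<exists>z. cball z (\<rho> u) \<subseteq> interior (xset S u) \<and>
      (\<forall>v w. path_word S v w u \<longrightarrow> word_map S w ` cball z (\<rho> u) \<inter> limit_set S = {}))"
    by metis
  define r where "r = Min (\<rho> ` verts S)"
  have "r > 0" unfolding r_def using \<rho> finite_verts y(1) by (subst Min_gr_iff) auto
  moreover have "\<exists>z. cball z r \<subseteq> interior (xset S u) \<and>
    (\<forall>v w. path_word S v w u \<longrightarrow> word_map S w ` cball z r \<inter> limit_set S = {})" if "u \<in> verts S" for u
  proof -
    have "r \<le> \<rho> u" unfolding r_def using finite_verts that by simp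
    then have "cball z r \<subseteq> cball z (\<rho> u)" for z by (simp add: subset_cball)
    then show ?thesis using \<rho>[OF that] by (meson disjoint_iff image_mono order_trans subset_iff)
  qed
  ultimately show ?thesis by blast
qed

section \<open>Distortion\<close>

lemma deriv_norm_id: "deriv_norm id (p::'a) = 1"
proof -
  obtain e :: 'a where e: "e \<in> Basis" using nonempty_Basis by blast
  have "linear_similarity (\<lambda>x::'a. x)"
    by (auto simp: linear_similarity_def linear_id[unfolded id_def] intro!: exI[of _ 1])
  from linear_similarity_onorm(2)[OF this, of e] e have "onorm (\<lambda>x::'a. x) = 1" by simp
  then show ?thesis by (simp add: deriv_norm_def id_def frechet_derivative_ident)
qed

text \<open>A multiplicative form of bounded distortion that also covers the empty word, where K
  \<ge> 1 is what is needed. Exchanging \<open>p\<close> and \<open>q\<close> gives the lower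
  bound.\<close>

definition distortion_constant :: "real \<Rightarrow> bool" where
  "distortion_constant K \<longleftrightarrow> K \<ge> 1 \<and>
     (\<forall>v u. \<forall>w\<in>fin_words S. \<forall>p\<in>sset S u. \<forall>q\<in>sset S u. path_word S v w u \<longrightarrow>
        deriv_norm (word_map S w) p \<le> K * deriv_norm (word_map S w) q)"

lemma distortion_constant_exists:
  assumes "bounded_distortion S"
  shows "\<exists>K. distortion_constant K"
proof -
  obtain K where K: "K \<ge> 1" and dist: "\<And>w p q. w \<in> fin_words S \<Longrightarrow> w \<noteq> [] \<Longrightarrow>
      p \<in> sset S (tvert S (last w)) \<Longrightarrow> q \<in> sset S (tvert S (last w)) \<Longrightarrow>
      deriv_norm (word_map S w) p / deriv_norm (word_map S w) q \<le> K"
    using assms unfolding bounded_distortion_def by blast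
  have "deriv_norm (word_map S w) p \<le> K * deriv_norm (word_map S w) q"
    if w: "w \<in> fin_words S" and path: "path_word S v w u" and p: "p \<in> sset S u" and q: "q \<in> sset S u"
    for v w u p q
  proof (cases "w = []")
    case True
    then show ?thesis using K by (simp add: deriv_norm_id)
  next
    case False
    have "deriv_norm (word_map S w) p / deriv_norm (word_map S w) q \<le> K"
      using dist[OF w False] path_word_last[OF path False] p q by simp
    moreover have "deriv_norm (word_map S w) q > 0"
      using deriv_norm_pos[OF path] q sset_subset_wset[OF path_word_verts(2)[OF path]] by blast
    ultimately show ?thesis by (simp add: field_simps)
  qed
  with K show ?thesis unfolding distortion_constant_def by blast
qed

lemma deriv_norm_distortion:
  assumes "distortion_constant K" "w \<in> fin_words S" "path_word S v w u" "p \<in> sset S u" "q \<in> sset S u"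
  shows "deriv_norm (word_map S w) p \<le> K * deriv_norm (word_map S w) q"
  using assms unfolding distortion_constant_def by blast

text \<open>The derivative is taken at the point that the composition maps to the coded point of
  \<omega>. With this choice the chain rule becomes a cocycle identity over the shift.\<close>

definition scale :: "nat \<Rightarrow> (nat \<Rightarrow> 'e) \<Rightarrow> real" where
  "scale n \<omega> = deriv_norm (word_map S (map \<omega> [0..<n])) (coding_map S ((shift ^^ n) \<omega>))"

lemma coding_map_shift_n_in_xset:
  "\<omega> \<in> inf_words S \<Longrightarrow> coding_map S ((shift ^^ n) \<omega>) \<in> xset S (ivert S (\<omega> n))"
  using coding_map_in_xset[OF funpow_shift_in_inf_words[of \<omega> S n]] by (simp add: funpow_shift)

lemma scale_pos:
  assumes "\<omega> \<in> inf_words S"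
  shows "scale n \<omega> > 0"
proof -
  note path = path_word_prefix[OF assms, of n]
  show ?thesis unfolding scale_def
    using deriv_norm_pos[OF path] xset_subset_wset[OF path_word_verts(2)[OF path]]
      coding_map_shift_n_in_xset[OF assms] by blast
qed

text \<open>Distortion bounds the derivative by K times the scale on all of the compact
  neighbourhood. The sets at the vertices need not be convex, so the mean value inequality is used
  only on small balls and the resulting local bound is spread by
  \<open>uniform_oscillation_bound\<close>.\<close>

lemma cylinder_diameter_bound:
  assumes bd: "bounded_distortion S"
  obtains C where "C > 0"
    "\<And>\<omega> n x y. \<omega> \<in> inf_words S \<Longrightarrow> x \<in> cylinder_image \<omega> n \<Longrightarrow> y \<in> cylinder_image \<omega> n \<Longrightarrow>
       dist x y \<le> C * scale n \<omega>"
proof -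
  obtain K where dc: "distortion_constant K" using distortion_constant_exists[OF bd] by blast
  then have K: "K \<ge> 1" by (simp add: distortion_constant_def)
  have ex: "\<exists>C>0. \<forall>\<omega>\<in>inf_words S. \<forall>n. ivert S (\<omega> n) = u \<longrightarrow>
      (\<forall>x\<in>cylinder_image \<omega> n. \<forall>y\<in>cylinder_image \<omega> n. dist x y \<le> C * scale n \<omega>)"
    if u: "u \<in> verts S" for u
  proof -
    \<comment> \<open>By compactness, balls of one radius about points of the vertex set stay inside
      the neighbourhood where distortion is controlled.\<close>
    obtain \<delta> where \<delta>: "\<delta> > 0" "\<And>p. p \<in> xset S u \<Longrightarrow> ball p \<delta> \<subseteq> sset S u"
    proof -
      obtain \<delta> where "\<delta> > 0" "(\<Union>p\<in>xset S u. ball p \<delta>) \<subseteq> interior (sset S u)"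
        using compact_subset_open_imp_ball_epsilon_subset[OF xset_compact[OF u] open_interior
            xset_subset_interior_sset[OF u]] by blast
      then show ?thesis using that interior_subset by blast
    qed
    obtain C where C: "C > 0" "\<And>(g::'a \<Rightarrow> 'a) b.
           (\<forall>p\<in>xset S u. \<forall>q\<in>xset S u. dist p q < \<delta> \<longrightarrow> dist (g p) (g q) \<le> b) \<Longrightarrow>
           (\<forall>p\<in>xset S u. \<forall>q\<in>xset S u. dist (g p) (g q) \<le> C * b)"
      using uniform_oscillation_bound[OF xset_connected[OF u] xset_compact[OF u] \<delta>(1)] by blast
    have "dist x y \<le> C * K * \<delta> * scale n \<omega>"
      if \<omega>: "\<omega> \<in> inf_words S" and n: "ivert S (\<omega> n) = u"
        and xy: "x \<in> cylinder_image \<omega> n" "y \<in> cylinder_image \<omega> n" for \<omega> n x y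
    proof -
      let ?f = "word_map S (map \<omega> [0..<n])"
      have path: "path_word S (ivert S (\<omega> 0)) (map \<omega> [0..<n]) u"
        using path_word_prefix[OF \<omega>, of n] n by simp
      have c: "coding_map S ((shift ^^ n) \<omega>) \<in> sset S u"
        using coding_map_shift_n_in_xset[OF \<omega>, of n] xset_subset_sset[OF u] n by auto
      have "dist (?f p) (?f q) \<le> K * scale n \<omega> * \<delta>"
        if pq: "p \<in> xset S u" "q \<in> xset S u" "dist p q < \<delta>" for p q
      proof -
        have "norm (?f p - ?f q) \<le> K * scale n \<omega> * norm (p - q)"
        proof (rule differentiable_bound[of "ball p \<delta>" _ "\<lambda>t. frechet_derivative ?f (at t)"])
          fix t assume "t \<in> ball p \<delta>"
          then have t: "t \<in> sset S u" using \<delta>(2) pq by blast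
          show "(?f has_derivative frechet_derivative ?f (at t)) (at t within ball p \<delta>)"
            using word_map_derivative[OF path] t sset_subset_wset[OF u] has_derivative_at_withinI by blast
          show "onorm (frechet_derivative ?f (at t)) \<le> K * scale n \<omega>"
            using deriv_norm_distortion[OF dc prefix_in_fin_words[OF \<omega>] path t c]
            by (simp add: scale_def deriv_norm_def)
        qed (use pq \<delta> in auto)
        also have "\<dots> \<le> K * scale n \<omega> * \<delta>"
          using pq K scale_pos[OF \<omega>, of n] by (intro mult_left_mono) (auto simp: dist_norm)
        finally show ?thesis by (simp add: dist_norm)
      qed
      then have "\<forall>p\<in>xset S u. \<forall>q\<in>xset S u. dist (?f p) (?f q) \<le> C * (K * scale n \<omega> * \<delta>)"
        by (intro C(2)) blast
      then show ?thesis using xy n by (auto simp: cylinder_image_def mult_ac)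
    qed
    moreover have "C * K * \<delta> > 0" using C(1) K \<delta>(1) by simp
    ultimately show ?thesis by blast
  qed
  then obtain C where C: "\<And>u. u \<in> verts S \<Longrightarrow> C u > 0 \<and> (\<forall>\<omega>\<in>inf_words S. \<forall>n. ivert S (\<omega> n) = u \<longrightarrow>
      (\<forall>x\<in>cylinder_image \<omega> n. \<forall>y\<in>cylinder_image \<omega> n. dist x y \<le> C u * scale n \<omega>))"
    by metis
  define M where "M = (\<Sum>u\<in>verts S. C u) + 1"
  have nn: "C u \<ge> 0" if "u \<in> verts S" for u using C that less_imp_le by blast
  have "dist x y \<le> M * scale n \<omega>"
    if \<omega>: "\<omega> \<in> inf_words S" and xy: "x \<in> cylinder_image \<omega> n" "y \<in> cylinder_image \<omega> n" for \<omega> n x y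
  proof -
    have u: "ivert S (\<omega> n) \<in> verts S" using path_word_verts(2)[OF path_word_prefix[OF \<omega>]] .
    have "dist x y \<le> C (ivert S (\<omega> n)) * scale n \<omega>" using C[OF u] \<omega> xy by blast
    also have "C (ivert S (\<omega> n)) \<le> (\<Sum>u\<in>verts S. C u)"
      using u nn finite_verts by (intro member_le_sum) auto
    then have "C (ivert S (\<omega> n)) * scale n \<omega> \<le> M * scale n \<omega>"
      using scale_pos[OF \<omega>, of n] by (intro mult_right_mono) (auto simp: M_def)
    finally show ?thesis .
  qed
  moreover have "M > 0" unfolding M_def using nn by (intro add_nonneg_pos sum_nonneg) auto
  ultimately show ?thesis using that by blast
qed

text \<open>Distortion makes the derivative norm at least \<open>scale n \<omega> / K\<close>
  throughout the hole, so the ball lemma for similarities applies with this lower bound.\<close>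

lemma cylinder_contains_ball:
  assumes dc: "distortion_constant K"
    and \<omega>: "\<omega> \<in> inf_words S" and \<rho>: "\<rho> > 0" "cball z \<rho> \<subseteq> interior (xset S (ivert S (\<omega> n)))"
  shows "ball (word_map S (map \<omega> [0..<n]) z) (scale n \<omega> / K * \<rho>) \<subseteq> word_map S (map \<omega> [0..<n]) ` ball z \<rho>"
proof -
  have K: "K \<ge> 1" using dc by (simp add: distortion_constant_def)
  note path = path_word_prefix[OF \<omega>, of n]
  note u = path_word_verts(2)[OF path]
  have sub: "cball z \<rho> \<subseteq> xset S (ivert S (\<omega> n))" using \<rho>(2) interior_subset by blast
  show ?thesis
  proof (rule ball_subset_image_of_similarity[where W = "wset S (ivert S (\<omega> n))"
        and D = "\<lambda>p. frechet_derivative (word_map S (map \<omega> [0..<n])) (at p)"])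
    show "cball z \<rho> \<subseteq> wset S (ivert S (\<omega> n))" using sub xset_subset_wset[OF u] by blast
    show "scale n \<omega> / K > 0" using scale_pos[OF \<omega>] K by simp
    fix p assume "p \<in> cball z \<rho>"
    then have "p \<in> sset S (ivert S (\<omega> n))" using sub xset_subset_sset[OF u] by blast
    moreover have "coding_map S ((shift ^^ n) \<omega>) \<in> sset S (ivert S (\<omega> n))"
      using coding_map_shift_n_in_xset[OF \<omega>] xset_subset_sset[OF u] by blast
    ultimately have "scale n \<omega> \<le> K * deriv_norm (word_map S (map \<omega> [0..<n])) p"
      unfolding scale_def using deriv_norm_distortion[OF dc prefix_in_fin_words[OF \<omega>] path] by blast
    then show "scale n \<omega> / K \<le> onorm (frechet_derivative (word_map S (map \<omega> [0..<n])) (at p))"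
      using K by (simp add: deriv_norm_def field_simps)
  qed (use wset_open[OF u] word_map_inj[OF path] word_map_derivative[OF path] \<rho>(1) in auto)
qed

lemma holes_at_all_scales:
  assumes bd: "bounded_distortion S"
    and irr: "finitely_irreducible S" and hole: "total_xset S - closure first_level \<noteq> {}"
  obtains c C m where "0 < c" "0 < C"
    "\<And>\<omega> n. \<omega> \<in> inf_words S \<Longrightarrow>
       \<exists>y. ball y (c * scale n \<omega>) \<subseteq> ball (coding_map S \<omega>) (C * scale n \<omega>) - limit_set S"
    "\<And>\<omega>. \<omega> \<in> inf_words S \<Longrightarrow> scale m \<omega> \<le> 1 / 2"
proof -
  obtain K where dc: "distortion_constant K" using distortion_constant_exists[OF bd] by blast
  then have K: "K \<ge> 1" by (simp add: distortion_constant_def)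
  obtain \<rho> where \<rho>: "\<rho> > 0" and holes: "\<And>u. u \<in> verts S \<Longrightarrow> \<exists>z. cball z \<rho> \<subseteq> interior (xset S u) \<and>
    (\<forall>v w. path_word S v w u \<longrightarrow> word_map S w ` cball z \<rho> \<inter> limit_set S = {})"
    using uniform_holes[OF irr hole] by blast
  obtain C where C: "C > 0" "\<And>\<omega> n x y. \<omega> \<in> inf_words S \<Longrightarrow> x \<in> cylinder_image \<omega> n \<Longrightarrow>
      y \<in> cylinder_image \<omega> n \<Longrightarrow> dist x y \<le> C * scale n \<omega>"
    using cylinder_diameter_bound[OF bd] by blast
  have ball: "\<exists>z. cball z \<rho> \<subseteq> xset S (ivert S (\<omega> n)) \<and>
      ball (word_map S (map \<omega> [0..<n]) z) (scale n \<omega> / K * \<rho>) \<subseteq> word_map S (map \<omega> [0..<n]) ` ball z \<rho> \<and>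
      word_map S (map \<omega> [0..<n]) ` cball z \<rho> \<inter> limit_set S = {}"
    if \<omega>: "\<omega> \<in> inf_words S" for \<omega> n
  proof -
    note path = path_word_prefix[OF \<omega>, of n]
    obtain z where z: "cball z \<rho> \<subseteq> interior (xset S (ivert S (\<omega> n)))"
      "word_map S (map \<omega> [0..<n]) ` cball z \<rho> \<inter> limit_set S = {}"
      using holes[OF path_word_verts(2)[OF path]] path by blast
    then show ?thesis
      using cylinder_contains_ball[OF dc \<omega> \<rho> z(1)] interior_subset by blast
  qed
  \<comment> \<open>Adding 1 to the diameter constant makes the inequality strict, so that the
    cylinder fits into an open ball.\<close>
  have "\<exists>y. ball y (\<rho> / K * scale n \<omega>) \<subseteq> ball (coding_map S \<omega>) ((C + 1) * scale n \<omega>) - limit_set S"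
    if \<omega>: "\<omega> \<in> inf_words S" for \<omega> n
  proof -
    let ?f = "word_map S (map \<omega> [0..<n])"
    obtain z where z: "cball z \<rho> \<subseteq> xset S (ivert S (\<omega> n))"
      "ball (?f z) (scale n \<omega> / K * \<rho>) \<subseteq> ?f ` ball z \<rho>" "?f ` cball z \<rho> \<inter> limit_set S = {}"
      using ball[OF \<omega>] by blast
    have *: "A \<subseteq> D - E" if "A \<subseteq> B" "B \<subseteq> C" "C \<subseteq> D" "B \<inter> E = {}" for A B C D E :: "'a set"
      using that by blast
    have "?f ` ball z \<rho> \<subseteq> cylinder_image \<omega> n"
      using z(1) ball_subset_cball unfolding cylinder_image_def by blast
    moreover have "cylinder_image \<omega> n \<subseteq> ball (coding_map S \<omega>) ((C + 1) * scale n \<omega>)"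
    proof
      fix x assume "x \<in> cylinder_image \<omega> n"
      then have "dist (coding_map S \<omega>) x \<le> C * scale n \<omega>"
        using C(2)[OF \<omega> coding_map_in_cylinder_image[OF \<omega>]] by blast
      also have "\<dots> < (C + 1) * scale n \<omega>" using scale_pos[OF \<omega>, of n] by (simp add: algebra_simps)
      finally show "x \<in> ball (coding_map S \<omega>) ((C + 1) * scale n \<omega>)" by simp
    qed
    moreover have "?f ` ball z \<rho> \<inter> limit_set S = {}" using z(3) ball_subset_cball by blast
    ultimately have "ball (?f z) (scale n \<omega> / K * \<rho>) \<subseteq> ball (coding_map S \<omega>) ((C + 1) * scale n \<omega>) - limit_set S"
      by (rule *[OF z(2)])
    then show ?thesis by (intro exI[of _ "?f z"]) (simp add: mult.commute)
  qed
  moreover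
  have "(\<lambda>n. contraction_ratio ^ n * K) \<longlonglongrightarrow> 0 * K"
    using contraction_ratio by (intro tendsto_intros LIMSEQ_realpow_zero) auto
  then have "\<forall>\<^sub>F n in sequentially. contraction_ratio ^ n * K < 1 / 2"
    by (intro order_tendstoD) auto
  then obtain m where m: "contraction_ratio ^ m * K < 1 / 2" by (auto simp: eventually_sequentially)
  have "scale m \<omega> \<le> 1 / 2" if \<omega>: "\<omega> \<in> inf_words S" for \<omega>
  proof -
    let ?f = "word_map S (map \<omega> [0..<m])"
    note path = path_word_prefix[OF \<omega>, of m]
    obtain z where z: "cball z \<rho> \<subseteq> xset S (ivert S (\<omega> m))"
      "ball (?f z) (scale m \<omega> / K * \<rho>) \<subseteq> ?f ` ball z \<rho>"
      using ball[OF \<omega>] by blast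
    \<comment> \<open>The Lipschitz bound is turned into a derivative bound by comparing radii: the
      image of the hole contains a ball of radius \<open>scale m \<omega> / K * \<rho>\<close> and
      lies in one of radius \<open>contraction_ratio ^ m * \<rho>\<close>.\<close>
    have "?f ` ball z \<rho> \<subseteq> cball (?f z) (contraction_ratio ^ m * \<rho>)"
    proof clarsimp
      fix y assume y: "dist z y < \<rho>"
      then have "z \<in> xset S (ivert S (\<omega> m))" "y \<in> xset S (ivert S (\<omega> m))" using z(1) \<rho> by auto
      from word_map_lipschitz[OF path this] have "dist (?f z) (?f y) \<le> contraction_ratio ^ m * dist z y"
        by simp
      also have "\<dots> \<le> contraction_ratio ^ m * \<rho>" using y contraction_ratio by (intro mult_left_mono) auto
      finally show "dist (?f z) (?f y) \<le> contraction_ratio ^ m * \<rho>" .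
    qed
    then have "ball (?f z) (scale m \<omega> / K * \<rho>) \<subseteq> cball (?f z) (contraction_ratio ^ m * \<rho>)" using z(2) by blast
    moreover have "scale m \<omega> / K * \<rho> > 0" using scale_pos[OF \<omega>] K \<rho> by simp
    ultimately have "scale m \<omega> / K * \<rho> \<le> contraction_ratio ^ m * \<rho>"
      by (simp add: ball_subset_cball_iff)
    then have "scale m \<omega> \<le> contraction_ratio ^ m * K" using \<rho> K by (simp add: field_simps)
    then show ?thesis using m by simp
  qed
  moreover have "\<rho> / K > 0" "C + 1 > 0" using \<rho> K C(1) by auto
  ultimately show ?thesis using that by blast
qed

end

section \<open>Measurability\<close>

text \<open>The count is a finite sum of indicators of open sets, and the eventual statement is a
  countable combination of such conditions.\<close>

lemma measurable_porosity_count: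
  assumes "s > 0" "\<beta> \<ge> 0"
  shows "{x \<in> space borel. \<forall>\<^sub>F i in sequentially.
      q * real i \<le> real (card {j\<in>{1..i}. porosity G x (s / 2 ^ j) > \<beta>})} \<in> sets (borel :: 'a::euclidean_space measure)"
proof -
  have [measurable]: "{x. \<beta> < porosity G x (s / 2 ^ j)} \<in> sets borel" for j
    using open_porosity_greater[of "s / 2 ^ j" \<beta> G] assms by simp
  have "real (card {j\<in>{1..i}. porosity G x (s / 2 ^ j) > \<beta>}) =
      (\<Sum>j\<in>{1..i}. indicator {x. \<beta> < porosity G x (s / 2 ^ j)} x)" for x i
    by (simp add: indicator_def sum.If_cases Int_def)
  then show ?thesis unfolding eventually_sequentially by simp
qed

text \<open>Cylinders over finite prefixes are open, so a set is open when it contains with each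
  word all words sharing a long enough prefix.\<close>

lemma openin_inf_words_topologyI:
  assumes "U \<subseteq> inf_words S"
    and "\<And>\<omega>. \<omega> \<in> U \<Longrightarrow> \<exists>n. \<forall>\<tau>\<in>inf_words S. (\<forall>k<n. \<tau> k = \<omega> k) \<longrightarrow> \<tau> \<in> U"
  shows "openin (inf_words_topology S) U"
proof (subst openin_subopen, intro ballI)
  fix \<omega> assume \<omega>: "\<omega> \<in> U"
  then obtain n where n: "\<forall>\<tau>\<in>inf_words S. (\<forall>k<n. \<tau> k = \<omega> k) \<longrightarrow> \<tau> \<in> U" using assms(2) by blast
  have \<omega>E: "\<omega> k \<in> edges S" for k using \<omega> assms(1) by (auto simp: inf_words_def)
  let ?P = "PiE UNIV (\<lambda>k. if k < n then {\<omega> k} else edges S)"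
  have "openin (product_topology (\<lambda>_. discrete_topology (edges S)) UNIV) ?P"
    using \<omega>E by (subst openin_PiE_gen) (auto intro: finite_subset[of _ "{..<n}"])
  then have "openin (inf_words_topology S) (?P \<inter> inf_words S)"
    unfolding inf_words_topology_def by (rule openin_subtopology_Int)
  moreover have "\<omega> \<in> ?P \<inter> inf_words S" using \<omega> \<omega>E assms(1) by auto
  moreover have "?P \<inter> inf_words S \<subseteq> U"
  proof
    fix \<tau> assume \<tau>: "\<tau> \<in> ?P \<inter> inf_words S"
    have "\<tau> k = \<omega> k" if "k < n" for k
      using \<tau> that PiE_mem[of \<tau> UNIV "\<lambda>k. if k < n then {\<omega> k} else edges S" k] by simp
    then show "\<tau> \<in> U" using n \<tau> by blast
  qed
  ultimately show "\<exists>T. openin (inf_words_topology S) T \<and> \<omega> \<in> T \<and> T \<subseteq> U" by blast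
qed

lemma topspace_inf_words_topology: "topspace (inf_words_topology S) = inf_words S"
  by (auto simp: inf_words_topology_def inf_words_def)

lemma continuous_map_shift: "continuous_map (inf_words_topology S) (inf_words_topology S) shift"
proof -
  have "continuous_map (inf_words_topology S) (discrete_topology (edges S)) (\<lambda>\<omega>. shift \<omega> k)" for k
    unfolding inf_words_topology_def shift_def
    by (rule continuous_map_from_subtopology[OF continuous_map_product_projection]) simp
  then have "continuous_map (inf_words_topology S) (product_topology (\<lambda>_. discrete_topology (edges S)) UNIV) shift"
    by (simp add: continuous_map_componentwise_UNIV)
  then show ?thesis
    using shift_in_inf_words topspace_inf_words_topology
    by (subst (2) inf_words_topology_def) (auto simp: continuous_map_in_subtopology)
qed

lemma openin_inf_words_sets:
  assumes "borel_prob_on_inf_words S \<mu>" "openin (inf_words_topology S) U"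
  shows "U \<in> sets \<mu>"
  using assms by (auto simp: borel_prob_on_inf_words_def inf_words_borel_def)

lemma measurable_shift:
  assumes "borel_prob_on_inf_words S \<mu>"
  shows "shift \<in> \<mu> \<rightarrow>\<^sub>M \<mu>"
proof (rule measurable_sigma_sets)
  show "sets \<mu> = sigma_sets (inf_words S) {U. openin (inf_words_topology S) U}"
    using assms by (simp add: borel_prob_on_inf_words_def inf_words_borel_def)
  show "{U. openin (inf_words_topology S) U} \<subseteq> Pow (inf_words S)"
    using openin_subset topspace_inf_words_topology by blast
  have sp: "space \<mu> = inf_words S" using assms by (simp add: borel_prob_on_inf_words_def)
  show "shift \<in> space \<mu> \<rightarrow> inf_words S" using sp shift_in_inf_words by auto
  fix U assume "U \<in> {U. openin (inf_words_topology S) U}"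
  then have "openin (inf_words_topology S) {\<omega> \<in> inf_words S. shift \<omega> \<in> U}"
    using openin_continuous_map_preimage[OF continuous_map_shift, of S U]
    by (simp add: topspace_inf_words_topology)
  moreover have "{\<omega> \<in> inf_words S. shift \<omega> \<in> U} = shift -` U \<inter> space \<mu>" using sp by auto
  ultimately show "shift -` U \<inter> space \<mu> \<in> sets \<mu>" using openin_inf_words_sets[OF assms] by simp
qed

lemma shift_measure_preserving:
  assumes "borel_prob_on_inf_words S \<mu>" "shift_invariant \<mu>"
  shows "distr \<mu> \<mu> shift = \<mu>"
proof (rule measure_eqI)
  fix A assume "A \<in> sets (distr \<mu> \<mu> shift)"
  then show "emeasure (distr \<mu> \<mu> shift) A = emeasure \<mu> A"
    using assms measurable_shift[OF assms(1)] by (simp add: emeasure_distr shift_invariant_def)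
qed simp

context conformal_system
begin

text \<open>The coding map is continuous: words with a long common prefix share a small cylinder
  image that contains both coded points.\<close>

lemma measurable_coding_map:
  assumes "borel_prob_on_inf_words S \<mu>"
  shows "coding_map S \<in> borel_measurable \<mu>"
proof (rule borel_measurableI)
  fix V :: "'a set" assume "open V"
  have sp: "space \<mu> = inf_words S" using assms by (simp add: borel_prob_on_inf_words_def)
  have "openin (inf_words_topology S) (coding_map S -` V \<inter> space \<mu>)"
  proof (rule openin_inf_words_topologyI)
    fix \<omega> assume "\<omega> \<in> coding_map S -` V \<inter> space \<mu>"
    then have \<omega>: "\<omega> \<in> inf_words S" "coding_map S \<omega> \<in> V" using sp by auto
    then obtain \<epsilon> where \<epsilon>: "\<epsilon> > 0" "ball (coding_map S \<omega>) \<epsilon> \<subseteq> V"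
      using \<open>open V\<close> open_contains_ball by blast
    obtain n where n: "\<forall>\<omega>\<in>inf_words S. \<forall>x\<in>cylinder_image \<omega> n. \<forall>y\<in>cylinder_image \<omega> n. dist x y < \<epsilon>"
      using cylinder_images_uniformly_small[OF \<epsilon>(1)] by blast
    \<comment> \<open>Agreement on n + 1 letters is required, since the n-th cylinder image also
      uses the vertex of the letter with index n.\<close>
    have "\<tau> \<in> coding_map S -` V \<inter> space \<mu>" if \<tau>: "\<tau> \<in> inf_words S" "\<forall>k<Suc n. \<tau> k = \<omega> k" for \<tau>
    proof -
      have eq: "map \<tau> [0..<n] = map \<omega> [0..<n]" using \<tau>(2) by simp
      have "cylinder_image \<tau> n = cylinder_image \<omega> n"
        unfolding cylinder_image_def eq using \<tau>(2) by simp
      then have "dist (coding_map S \<omega>) (coding_map S \<tau>) < \<epsilon>"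
        using n \<omega>(1) coding_map_in_cylinder_image[OF \<omega>(1), of n] coding_map_in_cylinder_image[OF \<tau>(1), of n]
        by auto
      then show ?thesis using \<epsilon>(2) \<tau>(1) sp by auto
    qed
    then show "\<exists>n. \<forall>\<tau>\<in>inf_words S. (\<forall>k<n. \<tau> k = \<omega> k) \<longrightarrow> \<tau> \<in> coding_map S -` V \<inter> space \<mu>" by blast
  qed (use sp in auto)
  then show "coding_map S -` V \<inter> space \<mu> \<in> sets \<mu>" by (rule openin_inf_words_sets[OF assms])
qed

lemma continuous_on_deriv_norm:
  assumes "e \<in> edges S"
  shows "continuous_on (wset S (tvert S e)) (deriv_norm (fmap S e))"
proof -
  obtain f' where f': "\<And>x. x \<in> wset S (tvert S e) \<Longrightarrow> (fmap S e has_derivative blinfun_apply (f' x)) (at x)"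
    and cont: "continuous_on (wset S (tvert S e)) f'"
    using fmap_C1[OF assms] unfolding C1_on_def by blast
  have "deriv_norm (fmap S e) x = norm (f' x)" if "x \<in> wset S (tvert S e)" for x
    using frechet_derivative_at[OF f'[OF that]] by (simp add: deriv_norm_def norm_blinfun.rep_eq)
  then show ?thesis using continuous_on_norm[OF cont] by (simp cong: continuous_on_cong)
qed

definition neg_log_deriv :: "(nat \<Rightarrow> 'e) \<Rightarrow> real" where
  "neg_log_deriv \<omega> = - ln (deriv_norm (fmap S (\<omega> 0)) (coding_map S (shift \<omega>)))"

lemma coding_map_shift_in_wset:
  assumes "\<omega> \<in> inf_words S"
  shows "coding_map S (shift \<omega>) \<in> wset S (tvert S (\<omega> 0))"
proof -
  have "tvert S (\<omega> 0) \<in> verts S" using assms by (simp add: inf_words_def tvert_in)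
  moreover have "coding_map S (shift \<omega>) \<in> xset S (tvert S (\<omega> 0))"
    using coding_map_in_xset[OF shift_in_inf_words[OF assms]] tvert_eq_ivert_Suc[OF assms, of 0]
    by (simp add: shift_def)
  ultimately show ?thesis using xset_subset_wset by blast
qed

text \<open>For each fixed first letter the function is Borel, and there are only countably many
  letters.\<close>

lemma measurable_neg_log_deriv:
  assumes "borel_prob_on_inf_words S \<mu>"
  shows "neg_log_deriv \<in> borel_measurable \<mu>"
proof -
  have sp: "space \<mu> = inf_words S" using assms by (simp add: borel_prob_on_inf_words_def)
  \<comment> \<open>Extension by 0 off the open set gives a globally Borel function; coded points
    stay inside the open set, so the values that matter are unchanged.\<close>
  define d where "d = (\<lambda>e x. if x \<in> wset S (tvert S e) then deriv_norm (fmap S e) x else 0)"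
  have d: "d e \<in> borel_measurable borel" if "e \<in> edges S" for e
    unfolding d_def using continuous_on_deriv_norm[OF that] wset_open[OF tvert_in[OF that]]
    by (intro borel_measurable_continuous_on_if) auto
  have "(\<lambda>\<omega>. coding_map S (shift \<omega>)) \<in> borel_measurable \<mu>"
    using measurable_compose[OF measurable_shift[OF assms] measurable_coding_map[OF assms]] .
  then have "(\<lambda>\<omega>. - ln (d e (coding_map S (shift \<omega>)))) \<in> borel_measurable \<mu>" if "e \<in> edges S" for e
    using measurable_compose[OF _ d[OF that]] by measurable
  moreover have "(\<lambda>\<omega>. \<omega> 0) \<in> \<mu> \<rightarrow>\<^sub>M count_space (edges S)"
    unfolding measurable_count_space_eq_countable[OF countable_edges]
  proof (intro conjI ballI)
    show "(\<lambda>\<omega>. \<omega> 0) \<in> space \<mu> \<rightarrow> edges S" using sp by (auto simp: inf_words_def)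
    fix e
    have "openin (inf_words_topology S) ((\<lambda>\<omega>. \<omega> 0) -` {e} \<inter> space \<mu>)"
      by (rule openin_inf_words_topologyI) (use sp in \<open>auto intro!: exI[of _ 1]\<close>)
    then show "(\<lambda>\<omega>. \<omega> 0) -` {e} \<inter> space \<mu> \<in> sets \<mu>" by (rule openin_inf_words_sets[OF assms])
  qed
  ultimately have "(\<lambda>\<omega>. - ln (d (\<omega> 0) (coding_map S (shift \<omega>)))) \<in> borel_measurable \<mu>"
    using countable_edges by (rule measurable_compose_countable'[where I = "edges S"])
  then show ?thesis
    by (rule measurable_cong[THEN iffD1, rotated])
      (use sp coding_map_shift_in_wset in \<open>simp add: neg_log_deriv_def d_def\<close>)
qed

text \<open>The truncation by \<open>ennreal\<close> makes the Lyapunov exponent the integral of the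
  positive part. The positive part is nonnegative at every argument, as the ergodic bound
  demands.\<close>

lemma integrable_positive_part:
  assumes "borel_prob_on_inf_words S \<mu>" "lyapunov_exponent S \<mu> < \<infinity>"
  shows "integrable \<mu> (\<lambda>\<omega>. max 0 (neg_log_deriv \<omega>))"
proof (rule integrableI_nonneg)
  show "(\<lambda>\<omega>. max 0 (neg_log_deriv \<omega>)) \<in> borel_measurable \<mu>"
    using measurable_neg_log_deriv[OF assms(1)] by measurable
  have "(\<integral>\<^sup>+ \<omega>. ennreal (max 0 (neg_log_deriv \<omega>)) \<partial>\<mu>) = lyapunov_exponent S \<mu>"
    unfolding lyapunov_exponent_def neg_log_deriv_def
    by (intro nn_integral_cong) (simp add: max_def ennreal_neg)
  then show "(\<integral>\<^sup>+ \<omega>. ennreal (max 0 (neg_log_deriv \<omega>)) \<partial>\<mu>) < \<infinity>" using assms(2) by simp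
qed simp

section \<open>Mean porosity\<close>

lemma scale_0 [simp]: "scale 0 \<omega> = 1"
  by (simp add: scale_def deriv_norm_id)

lemma scale_Suc:
  assumes "\<omega> \<in> inf_words S"
  shows "scale (Suc n) \<omega> = exp (- neg_log_deriv \<omega>) * scale n (shift \<omega>)"
proof -
  have e: "\<omega> 0 \<in> edges S" using assms by (simp add: inf_words_def)
  note sh = shift_in_inf_words[OF assms]
  have path: "path_word S (tvert S (\<omega> 0)) (map (shift \<omega>) [0..<n]) (ivert S (shift \<omega> n))"
    using path_word_prefix[OF sh, of n] tvert_eq_ivert_Suc[OF assms, of 0] by (simp add: shift_def)
  have p: "coding_map S ((shift ^^ n) (shift \<omega>)) \<in> wset S (ivert S (shift \<omega> n))"
    using coding_map_shift_n_in_xset[OF sh, of n] xset_subset_wset[OF path_word_verts(2)[OF path]] by blast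
  have "deriv_norm (fmap S (\<omega> 0)) (coding_map S (shift \<omega>)) > 0"
    using fmap_deriv_norm_pos[OF e] coding_map_shift_in_wset[OF assms] by blast
  then show ?thesis
    using deriv_norm_Cons[OF e path p] coding_map_prefix[OF sh, of n]
    unfolding scale_def map_upt_Suc_shift neg_log_deriv_def by (simp add: funpow_swap1)
qed

lemma scale_add:
  assumes "\<omega> \<in> inf_words S"
  shows "scale (n + k) \<omega> = scale n \<omega> * scale k ((shift ^^ n) \<omega>)"
  using assms
proof (induction n arbitrary: \<omega>)
  case (Suc n)
  then show ?case
    using Suc.IH[OF shift_in_inf_words[OF Suc.prems]] by (simp add: scale_Suc funpow_swap1)
qed simp

text \<open>With \<open>neg_log_deriv\<close> itself this would be an equality; the positive part
  can only enlarge the Birkhoff sum.\<close>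

lemma scale_lower_bound:
  assumes "\<omega> \<in> inf_words S"
  shows "exp (- birkhoff_sum shift (\<lambda>\<omega>. max 0 (neg_log_deriv \<omega>)) n \<omega>) \<le> scale n \<omega>"
  using assms
proof (induction n arbitrary: \<omega>)
  case (Suc n)
  show ?case
    using mult_mono[of "exp (- max 0 (neg_log_deriv \<omega>))" "exp (- neg_log_deriv \<omega>)", OF _
        Suc.IH[OF shift_in_inf_words[OF Suc.prems]]]
    by (simp add: scale_Suc[OF Suc.prems] birkhoff_sum_Suc exp_add[symmetric] exp_diff exp_minus divide_inverse)
qed simp

text \<open>Sampling every \<open>m\<close> steps at least halves the scale, so the samples yield
  distinct dyadic indices. The linear bound on the Birkhoff sums bounds these indices linearly,
  hence they have positive lower density. Comparing each hole with the nearby dyadic radius costs a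
  factor below 2.\<close>

lemma porous_scales_positive_density:
  assumes \<omega>: "\<omega> \<in> inf_words S" and c: "0 < c" and C: "0 < C"
    and hole: "\<And>n. \<exists>y. ball y (c * scale n \<omega>) \<subseteq> ball (coding_map S \<omega>) (C * scale n \<omega>) - limit_set S"
    and half: "\<And>\<omega>. \<omega> \<in> inf_words S \<Longrightarrow> scale m \<omega> \<le> 1 / 2"
    and growth: "\<And>n. birkhoff_sum shift (\<lambda>\<omega>. max 0 (neg_log_deriv \<omega>)) n \<omega> \<le> l * n + b"
    and a: "a = l * m / ln 2" "0 < a"
  shows "\<forall>\<^sub>F i in sequentially. 1 / (2 * a) * real i \<le>
    real (card {j\<in>{1..i}. porosity (limit_set S) (coding_map S \<omega>) (2 * C / 2 ^ j) > c / (2 * C)})"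
proof -
  define r where "r = (\<lambda>n. scale (n * m) \<omega>)"
  define t where "t = (\<lambda>n. log 2 (1 / r n))"
  \<comment> \<open>The added 1 makes the index at least 1 and, with the factor 2 in
    \<open>2 * C\<close>, keeps the dyadic radius no smaller than \<open>C * r n\<close>. Increments
    of \<open>t\<close> of at least 1 make the floors strictly increasing.\<close>
  define j where "j = (\<lambda>n. nat \<lfloor>1 + t n\<rfloor>)"
  have r: "r n > 0" for n using scale_pos[OF \<omega>] by (simp add: r_def)
  have t_Suc: "t n + 1 \<le> t (Suc n)" for n
  proof -
    have "r (Suc n) = r n * scale m ((shift ^^ (n * m)) \<omega>)"
      using scale_add[OF \<omega>, of "n * m" m] by (simp add: r_def add.commute)
    also have "\<dots> \<le> r n * (1 / 2)"
      using half[OF funpow_shift_in_inf_words[OF \<omega>]] r[of n] by (intro mult_left_mono) auto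
    finally have "2 * (1 / r n) \<le> 1 / r (Suc n)" using r[of n] r[of "Suc n"] by (simp add: field_simps)
    then have "log 2 (2 * (1 / r n)) \<le> t (Suc n)"
      unfolding t_def using r[of n] by (intro log_mono) auto
    moreover have "log 2 (2 * (1 / r n)) = 1 + t n"
      unfolding t_def using r[of n] by (subst log_mult) auto
    ultimately show ?thesis by simp
  qed
  have t_nonneg: "t n \<ge> 0" for n
  proof (induction n)
    case (Suc n)
    then show ?case using t_Suc[of n] by linarith
  qed (simp add: t_def r_def)
  show ?thesis
  proof (rule eventually_card_ge_of_linear_growth[where j = j and b = "1 + b / ln 2"])
    have "j n < j (Suc n)" for n using t_Suc[of n] t_nonneg[of n] unfolding j_def by linarith
    then show "strict_mono j" by (simp add: strict_mono_Suc_iff)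
    show "1 \<le> j n" for n using t_nonneg[of n] unfolding j_def by linarith
    show "0 < a" by (rule a)
    have jt: "real (j n) \<le> 1 + t n" "1 + t n < real (j n) + 1" for n
      using t_nonneg[of n] unfolding j_def by linarith+
    show "real (j n) \<le> a * real n + (1 + b / ln 2)" for n
    proof -
      have "exp (- (l * real (n * m) + b)) \<le> r n"
        using growth[of "n * m"] scale_lower_bound[OF \<omega>, of "n * m"] unfolding r_def
        by (meson exp_le_cancel_iff le_imp_neg_le order_trans)
      then have "- (l * real (n * m) + b) \<le> ln (r n)" using r[of n] by (simp add: ln_ge_iff)
      then have "- ln (r n) / ln 2 \<le> (l * real (n * m) + b) / ln 2" by (intro divide_right_mono) auto
      then have "t n \<le> (l * real (n * m) + b) / ln 2"
        using r[of n] by (simp add: t_def log_def ln_div)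
      also have "\<dots> = a * real n + b / ln 2" by (simp add: a(1) add_divide_distrib mult_ac)
      finally show ?thesis using jt(1)[of n] by simp
    qed
    show "c / (2 * C) < porosity (limit_set S) (coding_map S \<omega>) (2 * C / 2 ^ j n)" for n
    proof -
      define R where "R = 2 * C / 2 ^ j n"
      have R: "R > 0" using C by (simp add: R_def)
      have pow: "2 powr (1 + t n) = 2 / r n"
        using r[of n] by (simp add: t_def powr_add)
      have "2 powr real (j n) \<le> 2 powr (1 + t n)" "2 powr (1 + t n) < 2 powr (real (j n) + 1)"
        using jt[of n] by auto
      then have "2 ^ j n \<le> 2 / r n" "2 / r n < 2 * 2 ^ j n"
        unfolding pow by (simp_all add: powr_add powr_realpow)
      \<comment> \<open>The lower bound places the hole inside the dyadic ball; the strict upper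
        bound makes its relative size exceed \<open>c / (2 * C)\<close>.\<close>
      then have lo: "C * r n \<le> R" and hi: "R < 2 * C * r n"
        using r[of n] C by (simp_all add: R_def field_simps)
      obtain y where y: "ball y (c * r n) \<subseteq> ball (coding_map S \<omega>) (C * r n) - limit_set S"
        using hole[of "n * m"] by (auto simp: r_def)
      have "ball y ((c * r n / R) * R) \<subseteq> ball (coding_map S \<omega>) R - limit_set S"
        using y subset_ball[OF lo] R by auto
      moreover have "c / (2 * C) < c * r n / R"
        using hi R c C by (simp add: field_simps)
      moreover have "c * r n / R \<ge> 0" using c r[of n] R by (simp add: less_imp_le)
      ultimately show ?thesis unfolding R_def[symmetric] less_porosity_iff[OF R] by blast
    qed
  qed
qed

end

section \<open>Choice of the constants and transfer to the image measure\<close>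

theorem theorem1p2:
  fixes S :: "('v, 'e, real ^ 'n) cgdms"
    and \<mu> :: "(nat \<Rightarrow> 'e) measure"
  assumes "conformal_gdms S"
    and "compact_neighbourhoods S"
    and "bounded_distortion S"
    and "finitely_irreducible S"
    and "total_xset S - closure (\<Union>e\<in>edges S. fmap S e ` xset S (tvert S e)) \<noteq> {}"
    and "borel_prob_on_inf_words S \<mu>"
    and "shift_invariant \<mu>"
    and "shift_ergodic \<mu>"
    and "lyapunov_exponent S \<mu> < \<infinity>"
  shows "\<exists>\<alpha> p. 0 < \<alpha> \<and> \<alpha> < 1 \<and> 0 < p \<and> p < 1 \<and>
    (AE x in distr \<mu> borel (coding_map S). x \<in> limit_set S \<longrightarrow> mean_porous_at \<alpha> p (limit_set S) x)"
proof -
  interpret conformal_system S using assms(1,2) by unfold_locales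
  have prob: "prob_space \<mu>" and sp: "space \<mu> = inf_words S"
    using assms(6) by (simp_all add: borel_prob_on_inf_words_def)
  obtain c C m where c: "0 < c" and C: "0 < C"
    and hole: "\<And>\<omega> n. \<omega> \<in> inf_words S \<Longrightarrow>
       \<exists>y. ball y (c * scale n \<omega>) \<subseteq> ball (coding_map S \<omega>) (C * scale n \<omega>) - limit_set S"
    and half: "\<And>\<omega>. \<omega> \<in> inf_words S \<Longrightarrow> scale m \<omega> \<le> 1 / 2"
    using holes_at_all_scales[OF assms(3,4)] assms(5) unfolding first_level_def by blast
  let ?g = "\<lambda>\<omega>. max 0 (neg_log_deriv \<omega>)"
  \<comment> \<open>Any number strictly above the integral would do; adding 1 also makes it positive
    when the integral vanishes.\<close>
  define l where "l = integral\<^sup>L \<mu> ?g + 1"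
  have l: "integral\<^sup>L \<mu> ?g < l" "0 < l"
    by (auto simp: l_def intro!: add_nonneg_pos integral_nonneg)
  obtain \<omega>0 where "\<omega>0 \<in> inf_words S" using prob_space.not_empty[OF prob] sp by blast
  \<comment> \<open>The scale of order 0 is 1, which exceeds 1/2.\<close>
  then have "m > 0" using half[of \<omega>0] by (cases m) auto
  define a where "a = l * m / ln 2"
  have a: "a > 0" using l \<open>m > 0\<close> by (simp add: a_def)
  define \<beta> where "\<beta> = c / (2 * C)"
  define q where "q = 1 / (2 * a)"
  have \<beta>: "\<beta> > 0" and q: "q > 0" using c C a by (simp_all add: \<beta>_def q_def)
  \<comment> \<open>This condition with fixed constants implies mean porosity and defines a Borel
    set, so that its almost sure validity passes to the image measure.\<close>
  let ?P = "\<lambda>x. \<forall>\<^sub>F i in sequentially. q * real i \<le>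
    real (card {j\<in>{1..i}. porosity (limit_set S) x (2 * C / 2 ^ j) > \<beta>})"
  have "AE \<omega> in \<mu>. \<exists>b. \<forall>n. birkhoff_sum shift ?g n \<omega> \<le> l * n + b"
    by (rule ergodic_birkhoff_sum_linear_bound[OF measurable_shift[OF assms(6)]
          shift_measure_preserving[OF assms(6,7)] prob integrable_positive_part[OF assms(6,9)] _ _ l])
      (use assms(8) in \<open>auto simp: shift_ergodic_def\<close>)
  then have "AE \<omega> in \<mu>. ?P (coding_map S \<omega>)"
    using AE_space
  proof eventually_elim
    case (elim \<omega>)
    then obtain b where "\<And>n. birkhoff_sum shift ?g n \<omega> \<le> l * n + b" by blast
    from porous_scales_positive_density[OF _ c C hole half this a_def a] show ?case
      using elim(2) sp by (simp add: q_def \<beta>_def)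
  qed
  moreover have "{x \<in> space borel. ?P x} \<in> sets borel"
    using \<beta> C by (intro measurable_porosity_count) simp_all
  ultimately have "AE x in distr \<mu> borel (coding_map S). ?P x"
    by (rule AE_distr_iff[OF measurable_coding_map[OF assms(6)], THEN iffD2, rotated])
  \<comment> \<open>Halving gives the strict gaps below \<beta> and \<open>q\<close>, and the
    minimum with 1/2 keeps both constants below 1. Neither depends on \<open>x\<close>.\<close>
  then have "AE x in distr \<mu> borel (coding_map S). x \<in> limit_set S \<longrightarrow>
      mean_porous_at (min (1 / 2) (\<beta> / 2)) (min (1 / 2) (q / 2)) (limit_set S) x"
  proof eventually_elim
    case (elim x)
    then show ?case using C \<beta> q by (intro impI mean_porous_atI[of "2 * C" _ \<beta> _ q]) auto
  qed
  then show ?thesis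
    using \<beta> q by (intro exI[of _ "min (1 / 2) (\<beta> / 2)"] exI[of _ "min (1 / 2) (q / 2)"]) auto
qed

end
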